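(* Let $\lambda>0$, $\alpha>2$, $R_{\rm d}>1$, ${\rm SNR}>0$ and let $N_{\rm r}\ge 1$ be an integer. The sum of spectral efficiencies per unit area with direct CSIR (maximum ratio combining), $C_{\Sigma}^{\rm mrc}=\lambda\,\mathbb{E}\left[\log_2(1+{\rm SINR}^{\rm mrc})\right]$, is $$C_{\Sigma}^{\rm mrc}=\frac{\lambda\alpha}{2\ln 2}\int_{1}^{R_{\rm d}}\int_{0}^{\infty}\frac{1}{u}\exp\left(-\frac{\left({\rm sinc}\left(\frac{2}{\alpha}\right)u\right)^{\frac{\alpha}{2}}}{(\lambda\pi)^{\frac{\alpha}{2}}\,{\rm SNR}}-u\right)\frac{\sum_{n=1}^{N_{\rm r}}\binom{N_{\rm r}}{n}\left(\frac{{\rm sinc}\left(\frac{2}{\alpha}\right)u}{\lambda\pi r^{2}}\right)^{n\frac{\alpha}{2}}}{\left(1+\left(\frac{{\rm sinc}\left(\frac{2}{\alpha}\right)u}{\lambda\pi r^{2}}\right)^{\frac{\alpha}{2}}\right)^{N_{\rm r}}}\,{\rm d}u\;\frac{2r}{R_{\rm d}^2-1}\,{\rm d}r .$$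
   Context: Convention: ${\rm sinc}(x)=\frac{\sin(\pi x)}{\pi x}$. Network model. Single-antenna transmitters form a homogeneous Poisson point process (PPP) of density $\lambda$ in $\mathbb{R}^2$. Each transmitter has its own receiver with $N_{\rm r}$ antennas, located uniformly (with respect to area) in the annulus centred at the transmitter with inner radius $1$ and outer radius $R_{\rm d}$. All transmitters use the same spectrum. Quantities of the typical link (i.e. under the Palm distribution) are as follows: - The direct link distance $d_0$ has density $\frac{2r}{R_{\rm d}^2-1}$ on $[1,R_{\rm d}]$. - The interfering transmitters form a homogeneous PPP of density $\lambda$ on $\mathbb{R}^2$; $d_1,d_2,\dots$ denote their distances to the typical receiver. - The direct fading vector ${\bf h}_0$ and the interfering fading vectors ${\bf h}_1,{\bf h}_2,\ldots$ in $\mathbb{C}^{N_{\rm r}}$ are independent, with IID $\mathcal{CN}(0,1)$ entries (circularly symmetric complex Gaussian, $\mathbb{E}|\cdot|^2=1$). - Distances and fading are all mutually independent ($d_0$, the interferer point process, and the fading vectors). Maximum ratio combining uses the receive vector ${\bf w}={\bf h}_0/\|{\bf h}_0\|_2$, giving $${\rm SINR}^{\rm mrc}=\frac{H_0\,d_0^{-\alpha}}{I+\frac{1}{\rm SNR}},\qquad H_0=\|{\bf h}_0\|_2^2,\qquad I=\sum_{\ell\ge1}H_\ell\, d_\ell^{-\alpha},\qquad H_\ell=\frac{|{\bf h}_0^*{\bf h}_\ell|^2}{\|{\bf h}_0\|_2^2}.$$ Here $\alpha$ is the path-loss exponent and ${\rm SNR}=P/\sigma^2$ is the ratio of transmit power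 to noise variance. *)

theory Defs
  imports "HOL-Probability.Probability"
begin

text \<open>The theory \<^theory>\<open>HOL-Probability.Sinc_Integral\<close> provides the unnormalised function
  \<open>sin x / x\<close>; here \<open>sinc x = sin (\<pi> x) / (\<pi> x)\<close>.\<close>

definition nsinc :: "real \<Rightarrow> real" where
  "nsinc x = sinc (pi * x)"

text \<open>\<open>CN(0,1)\<close>: the real and the imaginary part are independent \<open>N(0,1/2)\<close>, so that
  \<open>E |Z|\<^sup>2 = 1\<close>. The second argument of \<^const>\<open>normal_density\<close> is the standard deviation, not the
  variance.\<close>

definition (in prob_space) std_complex_gaussian :: "('a \<Rightarrow> complex) \<Rightarrow> bool" where
  "std_complex_gaussian Z \<longleftrightarrow>
     distributed M lborel (\<lambda>\<omega>. Re (Z \<omega>)) (normal_density 0 (sqrt (1/2))) \<and>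
     distributed M lborel (\<lambda>\<omega>. Im (Z \<omega>)) (normal_density 0 (sqrt (1/2))) \<and>
     indep_var borel (\<lambda>\<omega>. Re (Z \<omega>)) borel (\<lambda>\<omega>. Im (Z \<omega>))"

definition (in prob_space) iid_complex_gaussian_vector :: "('a \<Rightarrow> complex ^ 'n) \<Rightarrow> bool" where
  "iid_complex_gaussian_vector v \<longleftrightarrow>
     (\<forall>i. std_complex_gaussian (\<lambda>\<omega>. v \<omega> $ i)) \<and>
     indep_vars (\<lambda>_. borel) (\<lambda>i \<omega>. v \<omega> $ i) UNIV"

text \<open>A point process is given by an enumeration \<open>X 0, X 1, \<dots>\<close> of its points (a homogeneous
  Poisson process of positive density has almost surely infinitely many). The counting variable
  \<open>point_count X A\<close> takes values in \<open>[0,\<infinity>]\<close>, hence the type \<^typ>\<open>ennreal\<close>.\<close>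

definition point_count :: "(nat \<Rightarrow> 'w \<Rightarrow> 'a) \<Rightarrow> 'a set \<Rightarrow> 'w \<Rightarrow> ennreal" where
  "point_count X A \<omega> = (\<Sum>l. indicator A (X l \<omega>))"

definition (in prob_space) homogeneous_ppp ::
    "real \<Rightarrow> (nat \<Rightarrow> 'a \<Rightarrow> 'b::euclidean_space) \<Rightarrow> bool" where
  "homogeneous_ppp lam X \<longleftrightarrow>
     (\<forall>l. random_variable borel (X l)) \<and>
     (\<forall>A\<in>sets borel. emeasure lborel A < \<infinity> \<longrightarrow>
        (\<forall>k::nat. prob {\<omega> \<in> space M. point_count X A \<omega> = of_nat k} =
           (lam * measure lborel A) ^ k / fact k * exp (- (lam * measure lborel A)))) \<and>
     (\<forall>A::nat \<Rightarrow> 'b set. disjoint_family A \<longrightarrow>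
        (\<forall>i. A i \<in> sets borel \<and> emeasure lborel (A i) < \<infinity>) \<longrightarrow>
        indep_vars (\<lambda>_. borel) (\<lambda>i. point_count X (A i)) UNIV)"

datatype source = Direct_Distance | Interferers | Direct_Fading | Interferer_Fading nat

text \<open>Coordinates are relative to the typical receiver, which sits at the origin: \<open>X l\<close> is the
  position of the \<open>l\<close>-th interferer, at distance \<open>norm (X l)\<close> from the receiver, and \<open>h l\<close> is its
  fading vector. The indices of the interferers start at \<open>0\<close>. The direct link has length \<open>d0\<close> and
  fading vector \<open>h0\<close>. Independence of the point process from the fading refers to the sequence
  \<open>X\<close>, because the enumeration decides which fading vector belongs to which point.\<close>

locale typical_link = prob_space M
  for M :: "'w measure" +
  fixes lam R_d :: real
    and d0 :: "'w \<Rightarrow> real"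
    and X :: "nat \<Rightarrow> 'w \<Rightarrow> real ^ 2"
    and h0 :: "'w \<Rightarrow> complex ^ 'n"
    and h :: "nat \<Rightarrow> 'w \<Rightarrow> complex ^ 'n"
  assumes direct_distance:
      "distributed M lborel d0 (\<lambda>r. indicator {1..R_d} r * ennreal (2 * r / (R_d\<^sup>2 - 1)))"
    and interferers: "homogeneous_ppp lam X"
    and direct_fading_measurable: "random_variable borel h0"
    and direct_fading: "iid_complex_gaussian_vector h0"
    and interferer_fading_measurable: "\<And>l. random_variable borel (h l)"
    and interferer_fading: "\<And>l. iid_complex_gaussian_vector (h l)"
    and independence: "indep_sets (\<lambda>s. case s of
        Direct_Distance \<Rightarrow> sets (vimage_algebra (space M) d0 borel)
      | Interferers \<Rightarrow>
          sets (vimage_algebra (space M) (\<lambda>\<omega> l. X l \<omega>) (\<Pi>\<^sub>M l\<in>UNIV. borel))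
      | Direct_Fading \<Rightarrow> sets (vimage_algebra (space M) h0 borel)
      | Interferer_Fading l \<Rightarrow> sets (vimage_algebra (space M) (h l) borel)) UNIV"

definition hermitian_inner :: "complex ^ 'n \<Rightarrow> complex ^ 'n \<Rightarrow> complex" where
  "hermitian_inner v w = (\<Sum>i\<in>UNIV. cnj (v $ i) * w $ i)"

definition interferer_gain :: "complex ^ 'n \<Rightarrow> complex ^ 'n \<Rightarrow> real" where
  "interferer_gain v w = (cmod (hermitian_inner v w))\<^sup>2 / (norm v)\<^sup>2"

text \<open>For \<open>alpha > 2\<close> the real-valued series below converges almost surely; its value where it
  diverges is irrelevant.\<close>

definition mrc_interference ::
    "real \<Rightarrow> (nat \<Rightarrow> 'w \<Rightarrow> real ^ 2) \<Rightarrow> ('w \<Rightarrow> complex ^ 'n) \<Rightarrow> (nat \<Rightarrow> 'w \<Rightarrow> complex ^ 'n)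
      \<Rightarrow> 'w \<Rightarrow> real" where
  "mrc_interference alpha X h0 h \<omega> =
     (\<Sum>l. interferer_gain (h0 \<omega>) (h l \<omega>) * norm (X l \<omega>) powr (- alpha))"

definition mrc_sinr ::
    "real \<Rightarrow> real \<Rightarrow> ('w \<Rightarrow> real) \<Rightarrow> (nat \<Rightarrow> 'w \<Rightarrow> real ^ 2) \<Rightarrow> ('w \<Rightarrow> complex ^ 'n)
      \<Rightarrow> (nat \<Rightarrow> 'w \<Rightarrow> complex ^ 'n) \<Rightarrow> 'w \<Rightarrow> real" where
  "mrc_sinr alpha SNR d0 X h0 h \<omega> =
     (norm (h0 \<omega>))\<^sup>2 * d0 \<omega> powr (- alpha) / (mrc_interference alpha X h0 h \<omega> + 1 / SNR)"

end

theory Submission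
  imports Defs
begin

text \<open>For \<open>a \<ge> 0\<close>, \<open>c > 0\<close> one has \<open>ln (1 + a / c) = \<integral> (1 - exp (- z a)) exp (- z c) dz / z\<close> over \<open>z > 0\<close>. With
  \<open>a = H\<^sub>0 d\<^sub>0 powr (- \<alpha>)\<close> and \<open>c = I + 1 / SNR\<close> the expectation only involves the Laplace transforms of
  \<open>H\<^sub>0\<close> (a Gamma variable) and of \<open>I\<close>. Given \<open>h\<^sub>0\<close> the gains \<open>H\<^sub>l\<close> are independent standard exponential
  variables, so the interferer at \<open>x\<close> contributes the factor \<open>1 / (1 + z |x| powr (- \<alpha>))\<close>, and the
  Laplace functional of the Poisson process yields
  \<open>E exp (- z I) = exp (- \<lambda> \<pi> z powr (2 / \<alpha>) / sinc (2 / \<alpha>))\<close>. The substitution that turns this into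
  \<open>exp (- u)\<close> is \<open>z = (sinc (2 / \<alpha>) u / (\<lambda> \<pi>)) powr (\<alpha> / 2)\<close>; it is built into the first integral.\<close>

subsection \<open>Elementary integrals\<close>

text \<open>Two obstacles shape the proof. First, \<open>h0\<close> occurs in the signal and in the
  gain of every interferer, so signal and interference are not independent by construction. They
  decouple because a gain is normalised by the length of \<open>h0\<close>: its conditional law is
  the same for every nonzero value of \<open>h0\<close>. Second, convergence of the interference
  series is not known beforehand; it is deduced from the Laplace transform. The computations
  therefore take place in [0, infinity], with exp (- infinity) = 0, where Tonelli's theorem asks for
  no integrability. Finiteness is recovered afterwards: for the series from the limit t -> 0 of its
  transform, for the expectation from a Gamma integral. The SINR is a quotient; the integral for the
  logarithm puts numerator and denominator into separate exponentials, so neither the distribution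
  function of the SINR nor that of the interference appears. The sinc comes from Beta (1 - d) (1 +
  d) with d = 2 / alpha, and the sum over n >= 1 is (1 + w)^N - 1, which divided by (1 + w)^N is one
  minus the Gamma transform.\<close>

lemma nn_integral_powr_weibull:
  fixes k b s :: real
  assumes k: "k > 0" and b: "b > 0" and s: "s > 0"
  shows "(\<integral>\<^sup>+u\<in>{0<..}. ennreal (b / u * (k * u) powr b * exp (- ((k * u) powr b * s))) \<partial>lborel) = ennreal (1 / s)"
proof -
  \<comment> \<open>With z = (k u)^b one has dz = (b / u) z du, so the integrand is exp (- z s) dz
    and \<open>?F\<close> is its antiderivative.\<close>
  let ?F = "\<lambda>u. - exp (- ((k * u) powr b * s)) / s"
  let ?f = "\<lambda>u. b / u * (k * u) powr b * exp (- ((k * u) powr b * s))"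
  have deriv: "(?F has_real_derivative ?f x) (at x)" if "x > 0" for x
  proof -
    have "(k * x) powr b = (k * x) powr (b - 1) * (k * x)"
      using that k by (simp add: powr_mult_base mult.commute)
    then show ?thesis using that k s
      by (auto intro!: derivative_eq_intros simp: field_simps)
  qed
  have cont: "isCont ?f x" if "x > 0" for x
    using that k by (auto intro!: continuous_intros)
  have W0: "((\<lambda>u. ?F u) \<longlongrightarrow> - 1 / s) (at_right 0)"
  proof -
    have "((\<lambda>u. (k * u) powr b) \<longlongrightarrow> 0) (at_right 0)"
      using k b by real_asymp
    then have "((\<lambda>u. - exp (- ((k * u) powr b * s)) / s) \<longlongrightarrow> - exp (- (0 * s)) / s) (at_right 0)"
      using s by (intro tendsto_intros) auto
    then show ?thesis by simp
  qed
  have Winf: "((\<lambda>u. ?F u) \<longlongrightarrow> 0) at_top"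
    using k b s by real_asymp
  have I: "set_integrable lborel (einterval 0 \<infinity>) ?f" and
    V: "(LBINT x=0..\<infinity>. ?f x) = 0 - (- 1 / s)"
    using interval_integral_FTC_nonneg[of 0 \<infinity> ?F ?f "- 1 / s" 0] deriv cont W0 Winf k b s
    by (auto simp: zero_ereal_def ereal_tendsto_simps)
  have e: "einterval 0 \<infinity> = {0<..}" by (auto simp: einterval_def)
  have "(\<integral>\<^sup>+u\<in>{0<..}. ennreal (?f u) \<partial>lborel) = (\<integral>\<^sup>+u. ennreal (indicator {0<..} u *\<^sub>R ?f u) \<partial>lborel)"
    by (intro nn_integral_cong) (auto simp: indicator_def)
  also have "\<dots> = ennreal (LINT u:{0<..}|lborel. ?f u)"
    using I b unfolding e set_integrable_def set_lebesgue_integral_def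
    by (intro nn_integral_eq_integral) (auto simp: indicator_def)
  also have "(LINT u:{0<..}|lborel. ?f u) = 1 / s"
    using V by (simp add: interval_lebesgue_integral_def e)
  finally show ?thesis .
qed

text \<open>With W = (k u)^b, the difference of exponentials is the integral of W exp (- W (t + c))
  over t in [0, a]. After exchanging the integrals, the one over u is the preceding lemma with s = t
  + c, and 1 / (t + c) remains, whose integral is the logarithm. The factor b / u is dz / z in the
  variable z = W.\<close>

lemma nn_integral_frullani_powr:
  fixes k b a c :: real
  assumes k: "k > 0" and b: "b > 0" and a: "a \<ge> 0" and c: "c > 0"
  shows "(\<integral>\<^sup>+u\<in>{0<..}. ennreal (b / u * (1 - exp (- ((k * u) powr b * a))) * exp (- ((k * u) powr b * c))) \<partial>lborel)
    = ennreal (ln (1 + a / c))"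
proof -
  let ?g = "\<lambda>u t. b / u * (k * u) powr b * exp (- ((k * u) powr b * (t + c)))"
  have inner: "ennreal (b / u * (1 - exp (- ((k * u) powr b * a))) * exp (- ((k * u) powr b * c)))
      = (\<integral>\<^sup>+t\<in>{0..a}. ennreal (?g u t) \<partial>lborel)" if "u > 0" for u
  proof -
    let ?F = "\<lambda>t. - (b / u * exp (- ((k * u) powr b * (t + c))))"
    have "(?g u has_integral (?F a - ?F 0)) {0..a}"
      using a that
      by (intro fundamental_theorem_of_calculus)
         (auto intro!: derivative_eq_intros simp: has_real_derivative_iff_has_vector_derivative[symmetric])
    then have "(\<integral>\<^sup>+t\<in>{0..a}. ennreal (?g u t) \<partial>lborel) = ennreal (?F a - ?F 0)"
      using that b by (intro nn_integral_has_integral_lebesgue') auto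
    also have "?F a - ?F 0 = b / u * (1 - exp (- ((k * u) powr b * a))) * exp (- ((k * u) powr b * c))"
      by (simp add: algebra_simps flip: exp_add)
    finally show ?thesis by simp
  qed
  have "(\<integral>\<^sup>+u\<in>{0<..}. ennreal (b / u * (1 - exp (- ((k * u) powr b * a))) * exp (- ((k * u) powr b * c))) \<partial>lborel)
    = (\<integral>\<^sup>+u. (\<integral>\<^sup>+t. ennreal (?g u t) * indicator {0..a} t * indicator {0<..} u \<partial>lborel) \<partial>lborel)"
  proof (rule nn_integral_cong)
    show "ennreal (b / u * (1 - exp (- ((k * u) powr b * a))) * exp (- ((k * u) powr b * c))) * indicator {0<..} u
        = (\<integral>\<^sup>+t. ennreal (?g u t) * indicator {0..a} t * indicator {0<..} u \<partial>lborel)" for u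
      using inner[of u] by (cases "u > 0") auto
  qed
  also have "\<dots> = (\<integral>\<^sup>+t. (\<integral>\<^sup>+u. ennreal (?g u t) * indicator {0..a} t * indicator {0<..} u \<partial>lborel) \<partial>lborel)"
    by (rule lborel_pair.Fubini'[symmetric]) measurable
  also have "\<dots> = (\<integral>\<^sup>+t\<in>{0..a}. ennreal (1 / (t + c)) \<partial>lborel)"
    using nn_integral_powr_weibull[OF k b] c
    by (intro nn_integral_cong) (auto simp: indicator_def)
  also have "\<dots> = ennreal (ln (a + c) - ln (0 + c))"
  proof (intro nn_integral_has_integral_lebesgue' fundamental_theorem_of_calculus)
    show "((\<lambda>t. ln (t + c)) has_vector_derivative 1 / (x + c)) (at x within {0..a})" if "x \<in> {0..a}" for x
      unfolding has_real_derivative_iff_has_vector_derivative[symmetric]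
      using that c by (auto intro!: derivative_eq_intros)
  qed (use a c in auto)
  also have "ln (a + c) - ln (0 + c) = ln (1 + a / c)"
    using a c ln_divide_pos[of "a + c" c] by (simp add: add_divide_distrib add.commute)
  finally show ?thesis .
qed

text \<open>Here Gamma (1 + d) = d Gamma (d) and Gamma (2) = 1, so the reflection formula gives pi d
  / sin (pi d).\<close>

lemma Beta_reflection_real:
  fixes d :: real
  assumes "0 < d" "d < 1"
  shows "Beta (1 - d) (1 + d) = 1 / nsinc d"
proof -
  have "complex_of_real (Gamma d * Gamma (1 - d)) = complex_of_real (pi / sin (pi * d))"
    using Gamma_reflection_complex[of "of_real d"]
      Gamma_complex_of_real[of d] Gamma_complex_of_real[of "1 - d"]
    by (simp add: sin_of_real[symmetric])
  then have "Gamma d * Gamma (1 - d) = pi / sin (pi * d)" by (simp only: of_real_eq_iff)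
  moreover have "Gamma (1 + d) = d * Gamma d"
    using Gamma_plus1[of d] nonpos_Ints_nonpos[of d] assms by (auto simp: add.commute)
  ultimately have "Gamma (1 - d) * Gamma (1 + d) = d * (pi / sin (pi * d))"
    by (metis mult.commute mult.left_commute)
  moreover have "Gamma (1 - d + (1 + d)) = 1"
    using Gamma_numeral[of "Num.Bit0 Num.One", where 'a = real] by simp
  ultimately show ?thesis
    using assms by (simp add: Beta_def nsinc_def)
qed

lemma nsinc_pos: "0 < d \<Longrightarrow> d < 1 \<Longrightarrow> nsinc d > 0"
  by (simp add: nsinc_def sin_gt_zero)

text \<open>Layer-cake instead of polar coordinates: for 0 < t < 1 the set where the integrand
  exceeds t is, up to the origin, a disc, and its area as a function of t is a constant times t^(-d)
  (1 - t)^d with d = 2 / alpha. Integrating over t gives the Beta function. The singularity t^(-d)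
  is integrable because alpha > 2.\<close>

lemma nn_integral_path_loss_plane:
  fixes alpha z :: real
  assumes alpha: "alpha > 2" and z: "z \<ge> 0"
  shows "(\<integral>\<^sup>+x. ennreal (1 - 1 / (1 + z * norm x powr (- alpha))) \<partial>(lborel :: (real^2) measure))
    = ennreal (pi * z powr (2 / alpha) / nsinc (2 / alpha))"
proof (cases "z = 0")
  case False
  with z have z: "z > 0" by simp
  define d where "d = 2 / alpha"
  have d: "0 < d" "d < 1" using alpha by (auto simp: d_def)
  define v where "v = (\<lambda>x::real^2. 1 - 1 / (1 + z * norm x powr (- alpha)))"
  have v01: "0 \<le> v x" "v x < 1" for x
    using z by (auto simp: v_def field_simps add_nonneg_pos add_pos_nonneg)
  have [measurable]: "v \<in> borel_measurable borel" unfolding v_def by measurable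
  have "ennreal (v x) = (\<integral>\<^sup>+t. indicator {0<..<v x} t \<partial>lborel)" for x
    using v01[of x] by simp
  then have "(\<integral>\<^sup>+x. ennreal (v x) \<partial>lborel) = (\<integral>\<^sup>+x. (\<integral>\<^sup>+t. indicator {0<..<v x} t \<partial>lborel) \<partial>lborel)"
    by simp
  also have "\<dots> = (\<integral>\<^sup>+x. (\<integral>\<^sup>+t. indicator {p. 0 < snd p \<and> snd p < v (fst p)} (x, t) \<partial>lborel) \<partial>lborel)"
    by (intro nn_integral_cong) (auto simp: indicator_def)
  also have "\<dots> = (\<integral>\<^sup>+t. (\<integral>\<^sup>+x. indicator {p. 0 < snd p \<and> snd p < v (fst p)} (x, t) \<partial>lborel) \<partial>lborel)"
    by (rule lborel_pair.Fubini'[symmetric]) measurable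
  also have "\<dots> = (\<integral>\<^sup>+t\<in>{0..1}. ennreal (pi * z powr d * (t powr ((1 - d) - 1) * (1 - t) powr ((1 + d) - 1))) \<partial>lborel)"
  proof (rule nn_integral_cong_AE)
    have "AE t in lborel. t \<noteq> (0::real)" "AE t in lborel. t \<noteq> (1::real)"
      by (rule AE_lborel_singleton)+
    then show "AE t in lborel. (\<integral>\<^sup>+x. indicator {p. 0 < snd p \<and> snd p < v (fst p)} (x, t) \<partial>lborel)
        = ennreal (pi * z powr d * (t powr ((1 - d) - 1) * (1 - t) powr ((1 + d) - 1))) * indicator {0..1} t"
    proof eventually_elim
      case (elim t)
      show ?case
      proof (cases "0 < t \<and> t < 1")
        case True
        define q where "q = z * (1 - t) / t"
        have q: "q > 0" using True z by (simp add: q_def)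
        \<comment> \<open>The origin must be excluded: \<open>0 powr (- alpha)\<close> is 0, hence
          \<open>v 0 = 0\<close>, although the origin lies in the ball. A single point is negligible
          in the integral.\<close>
        have iff: "t < v x \<longleftrightarrow> x \<in> ball 0 (q powr (1 / alpha))" if "x \<noteq> 0" for x :: "real^2"
        proof -
          have n: "norm x powr alpha > 0" using that by simp
          have "v x = z / (norm x powr alpha + z)"
            using n z add_pos_pos[OF n z] by (simp add: v_def powr_minus_divide divide_simps)
          then have "t < v x \<longleftrightarrow> norm x powr alpha < q"
            using True z n add_pos_pos[OF n z] by (simp add: q_def less_divide_eq algebra_simps)
          also have "\<dots> \<longleftrightarrow> norm x < q powr (1 / alpha)"
          proof -
            have "(q powr (1 / alpha)) powr alpha = q"
              using q alpha by (simp add: powr_powr)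
            then show ?thesis
              using powr_less_mono2[of alpha "norm x" "q powr (1 / alpha)"]
                powr_mono2[of alpha "q powr (1 / alpha)" "norm x"] alpha q
              by (cases "norm x < q powr (1 / alpha)") auto
          qed
          finally show ?thesis by simp
        qed
        have "(\<integral>\<^sup>+x. indicator {p. 0 < snd p \<and> snd p < v (fst p)} (x, t) \<partial>lborel)
            = (\<integral>\<^sup>+x. indicator (ball (0::real^2) (q powr (1 / alpha))) x \<partial>lborel)"
        proof (rule nn_integral_cong_AE)
          show "AE x in lborel. indicator {p. 0 < snd p \<and> snd p < v (fst p)} (x, t)
              = (indicator (ball (0::real^2) (q powr (1 / alpha))) x :: ennreal)"
            using AE_lborel_singleton[of "0::real^2"]
          proof eventually_elim
            case (elim x)
            then show ?case using iff[of x] True by (simp add: indicator_def del: mem_ball)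
          qed
        qed
        also have "\<dots> = ennreal (pi * (q powr (1 / alpha))\<^sup>2)"
          by (simp add: emeasure_ball unit_ball_vol_2)
        also have "(q powr (1 / alpha))\<^sup>2 = q powr d"
          using q by (simp add: powr_power d_def)
        also have "\<dots> = z powr d * (t powr ((1 - d) - 1) * (1 - t) powr ((1 + d) - 1))"
          using True z by (simp add: q_def powr_mult powr_divide powr_minus_divide)
        finally show ?thesis using True by (simp add: mult.assoc)
      next
        case False
        with elim have "t < 0 \<or> t > 1" by auto
        then have "(\<integral>\<^sup>+x. indicator {p. 0 < snd p \<and> snd p < v (fst p)} (x, t) \<partial>lborel) = (\<integral>\<^sup>+x. 0 \<partial>(lborel::(real^2) measure))"
          using v01(2) by (intro nn_integral_cong) (auto simp: indicator_def dest: less_trans)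
        then show ?thesis using \<open>t < 0 \<or> t > 1\<close> by auto
      qed
    qed
  qed
  also have "\<dots> = ennreal (pi * z powr d * Beta (1 - d) (1 + d))"
    using d z
    by (intro nn_integral_has_integral_lebesgue' has_integral_mult_right has_integral_Beta_real) auto
  finally show ?thesis
    using d by (simp add: Beta_reflection_real v_def d_def)
qed simp

subsection \<open>Gaussian vectors\<close>

text \<open>The exponents add up to x^2 (1 + 2 c s^2) / (2 s^2), again a centred Gaussian with a
  smaller deviation; the quotient of the two normalising constants is the prefactor.\<close>

lemma normal_density_times_exp_square:
  fixes c s :: real
  assumes s: "s > 0" and c: "c \<ge> 0"
  shows "normal_density 0 s x * exp (- (c * x\<^sup>2))
    = 1 / sqrt (1 + 2 * c * s\<^sup>2) * normal_density 0 (s / sqrt (1 + 2 * c * s\<^sup>2)) x"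
proof -
  define q where "q = 1 + 2 * c * s\<^sup>2"
  have q: "q > 0" using c by (simp add: q_def add_pos_nonneg)
  have "sqrt (2 * pi * s\<^sup>2) = sqrt (2 * pi * (s / sqrt q)\<^sup>2) * sqrt q"
    using q by (simp add: real_sqrt_mult[symmetric] power_divide del: real_sqrt_mult)
  moreover have "exp (- x\<^sup>2 / (2 * s\<^sup>2)) * exp (- (c * x\<^sup>2)) = exp (- x\<^sup>2 / (2 * (s / sqrt q)\<^sup>2))"
    using q s by (simp add: power_divide q_def field_simps flip: exp_add)
  ultimately show ?thesis
    using s q by (simp add: normal_density_def flip: q_def)
qed

lemma
  fixes c s :: real
  assumes "s > 0" "c \<ge> 0"
  shows normal_density_exp_square_integrable:
      "integrable lborel (\<lambda>x. normal_density 0 s x * exp (- (c * x\<^sup>2)))"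
    and normal_density_exp_square_integral:
      "(\<integral>x. normal_density 0 s x * exp (- (c * x\<^sup>2)) \<partial>lborel) = 1 / sqrt (1 + 2 * c * s\<^sup>2)"
proof -
  have q: "0 < s / sqrt (1 + 2 * c * s\<^sup>2)" using assms by (simp add: add_pos_nonneg)
  show "integrable lborel (\<lambda>x. normal_density 0 s x * exp (- (c * x\<^sup>2)))"
    unfolding normal_density_times_exp_square[OF assms]
    by (intro integrable_mult_right integrable_normal_density q)
  show "(\<integral>x. normal_density 0 s x * exp (- (c * x\<^sup>2)) \<partial>lborel) = 1 / sqrt (1 + 2 * c * s\<^sup>2)"
    unfolding normal_density_times_exp_square[OF assms] integral_mult_right_zero
    using integral_normal_density[OF q] by simp
qed

lemma (in prob_space) integrable_iexp_rv:
  "X \<in> borel_measurable M \<Longrightarrow> integrable M (\<lambda>\<omega>. iexp (X \<omega> :: real))"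
  by (rule integrable_const_bound[where B = 1]) auto

lemma (in prob_space) expectation_exp_square_normal:
  assumes Z: "distributed M lborel Z (normal_density 0 s)" and s: "s > 0" and c: "c \<ge> 0"
  shows "expectation (\<lambda>\<omega>. exp (- (c * (Z \<omega>)\<^sup>2))) = 1 / sqrt (1 + 2 * c * s\<^sup>2)"
  using distributed_integral[OF Z, of "\<lambda>x. exp (- (c * x\<^sup>2))"] normal_density_exp_square_integral[OF s c]
  by simp

lemma (in prob_space) expectation_iexp_normal:
  assumes Z: "distributed M lborel Z (normal_density 0 s)" and s: "s > 0"
  shows "(CLINT \<omega>|M. iexp (t * Z \<omega>)) = of_real (exp (- (s\<^sup>2 * t\<^sup>2 / 2)))"
proof -
  have D: "distributed M lborel (\<lambda>x. Z x / s) std_normal_density"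
    using Z normal_standard_normal_convert[OF s, of Z 0] by simp
  have [measurable]: "Z \<in> borel_measurable M" using distributed_measurable[OF Z] by simp
  have "(CLINT \<omega>|M. iexp (t * Z \<omega>)) = (CLINT \<omega>|M. iexp ((t * s) * (Z \<omega> / s)))"
    using s by simp
  also have "\<dots> = (CLINT x|distr M lborel (\<lambda>x. Z x / s). iexp ((t * s) * x))"
    by (subst integral_distr) auto
  also have "\<dots> = char std_normal_distribution (t * s)"
    by (simp add: distributed_distr_eq_density[OF D] char_def)
  also have "\<dots> = of_real (exp (- (s\<^sup>2 * t\<^sup>2 / 2)))"
    by (simp add: char_std_normal_distribution power_mult_distrib mult.commute)
  finally show ?thesis .
qed

text \<open>The Gaussian in \<open>A\<close> and \<open>B\<close> is linearised: \<open>exp (- t a\<^sup>2)\<close> is the characteristic function of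
  \<open>N(0, 2t)\<close> at \<open>a\<close>. This way the joint law of \<open>A\<close> and \<open>B\<close> need not be determined.\<close>

lemma (in prob_space) expectation_exp_square_of_char:
  fixes A B :: "'a \<Rightarrow> real"
  assumes [measurable]: "A \<in> borel_measurable M" "B \<in> borel_measurable M"
    and char: "\<And>x y. (CLINT \<omega>|M. iexp (x * A \<omega> + y * B \<omega>)) = of_real (exp (- (\<kappa> * (x\<^sup>2 + y\<^sup>2))))"
    and \<kappa>: "\<kappa> \<ge> 0" and t: "t > 0"
  shows "expectation (\<lambda>\<omega>. exp (- (t * ((A \<omega>)\<^sup>2 + (B \<omega>)\<^sup>2)))) = 1 / (1 + 4 * \<kappa> * t)"
proof -
  define s where "s = sqrt (2 * t)"
  define N where "N = density lborel (normal_density 0 s)"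
  have s: "s > 0" "s\<^sup>2 = 2 * t" using t by (auto simp: s_def)
  have [simp, measurable_cong]: "sets N = sets borel" by (simp add: N_def)
  have [simp]: "space N = UNIV" by (simp add: N_def)
  interpret N: prob_space N unfolding N_def by (rule prob_space_normal_density[OF s(1)])
  interpret P: pair_prob_space N M ..
  have id: "distributed N lborel (\<lambda>x. x) (normal_density 0 s)"
    unfolding distributed_def by (auto simp: N_def distr_id2)
  have gauss: "of_real (exp (- (t * a\<^sup>2))) = (CLINT x|N. iexp (x * a))" for a
    using N.expectation_iexp_normal[OF id s(1), of a] s(2) by (simp add: mult.commute)
  have sq: "(\<integral>x. exp (- (\<kappa> * x\<^sup>2)) \<partial>N) = 1 / sqrt (1 + 4 * \<kappa> * t)"
    using N.expectation_exp_square_normal[OF id s(1) \<kappa>] s(2) by (simp add: ac_simps)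
  \<comment> \<open>All integrands below have modulus at most 1 on a product of probability spaces,
    which is all that Fubini requires. The two auxiliary Gaussians are moved out one after the
    other, so that two-fold products suffice.\<close>
  have swap: "(CLINT \<omega>|M. CLINT x|N. f x \<omega>) = (CLINT x|N. CLINT \<omega>|M. f x \<omega>)"
    if [measurable]: "case_prod f \<in> borel_measurable (N \<Otimes>\<^sub>M M)" and "\<And>x \<omega>. norm (f x \<omega>) \<le> 1" 
    for f :: "real \<Rightarrow> 'a \<Rightarrow> complex"
    by (rule P.Fubini_integral, rule P.P.integrable_const_bound[where B = 1]) (use that in auto)
  have "complex_of_real (expectation (\<lambda>\<omega>. exp (- (t * ((A \<omega>)\<^sup>2 + (B \<omega>)\<^sup>2)))))
    = (CLINT \<omega>|M. of_real (exp (- (t * (A \<omega>)\<^sup>2))) * of_real (exp (- (t * (B \<omega>)\<^sup>2))))"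
    by (subst integral_complex_of_real[symmetric]) (simp add: exp_add[symmetric] algebra_simps flip: of_real_mult)
  also have "\<dots> = (CLINT \<omega>|M. CLINT x|N. iexp (x * A \<omega>) * of_real (exp (- (t * (B \<omega>)\<^sup>2))))"
    by (simp add: gauss)
  also have "\<dots> = (CLINT x|N. CLINT \<omega>|M. iexp (x * A \<omega>) * of_real (exp (- (t * (B \<omega>)\<^sup>2))))"
    using t by (intro swap) (auto simp: norm_mult)
  also have "\<dots> = (CLINT x|N. CLINT \<omega>|M. CLINT y|N. iexp (x * A \<omega> + y * B \<omega>))"
    by (simp add: gauss exp_add distrib_left)
  also have "\<dots> = (CLINT x|N. CLINT y|N. CLINT \<omega>|M. iexp (x * A \<omega> + y * B \<omega>))"
    by (intro Bochner_Integration.integral_cong refl swap) auto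
  \<comment> \<open>\<open>char\<close> turns the inner expectation into a product of a function of
    x and a function of y; each contributes the factor 1 / sqrt (1 + 4 \<open>\<kappa>\<close>
    t).\<close>
  also have "\<dots> = (CLINT x|N. CLINT y|N. of_real (exp (- (\<kappa> * x\<^sup>2)) * exp (- (\<kappa> * y\<^sup>2))))"
    unfolding char by (simp add: exp_add[symmetric] algebra_simps)
  also have "\<dots> = of_real ((\<integral>x. exp (- (\<kappa> * x\<^sup>2)) \<partial>N) * (\<integral>x. exp (- (\<kappa> * x\<^sup>2)) \<partial>N))"
    unfolding integral_complex_of_real by simp
  also have "\<dots> = of_real (1 / (1 + 4 * \<kappa> * t))"
    unfolding sq using \<kappa> t by (simp add: real_sqrt_mult_self flip: of_real_mult)
  finally show ?thesis by (simp only: of_real_eq_iff)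
qed

text \<open>Each part has variance 1/2, and a centred normal of that variance has characteristic
  function exp (- x^2 / 4).\<close>

lemma (in prob_space) std_complex_gaussian_iexp:
  assumes Z: "std_complex_gaussian Z"
  shows "(CLINT \<omega>|M. iexp (x * Re (Z \<omega>) + y * Im (Z \<omega>))) = of_real (exp (- ((x\<^sup>2 + y\<^sup>2) / 4)))"
proof -
  have R: "distributed M lborel (\<lambda>\<omega>. Re (Z \<omega>)) (normal_density 0 (sqrt (1/2)))"
   and I: "distributed M lborel (\<lambda>\<omega>. Im (Z \<omega>)) (normal_density 0 (sqrt (1/2)))"
   and ind: "indep_var borel (\<lambda>\<omega>. Re (Z \<omega>)) borel (\<lambda>\<omega>. Im (Z \<omega>))"
    using Z by (auto simp: std_complex_gaussian_def)
  have [measurable]: "(\<lambda>\<omega>. Re (Z \<omega>)) \<in> borel_measurable M" "(\<lambda>\<omega>. Im (Z \<omega>)) \<in> borel_measurable M"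
    using distributed_measurable[OF R] distributed_measurable[OF I] by auto
  have "(CLINT \<omega>|M. iexp (x * Re (Z \<omega>) + y * Im (Z \<omega>)))
      = (CLINT \<omega>|M. iexp (x * Re (Z \<omega>)) * iexp (y * Im (Z \<omega>)))"
    by (simp add: exp_add distrib_left)
  also have "\<dots> = (CLINT \<omega>|M. iexp (x * Re (Z \<omega>))) * (CLINT \<omega>|M. iexp (y * Im (Z \<omega>)))"
    using indep_var_compose[OF ind, of "\<lambda>r. iexp (x * r)" borel "\<lambda>r. iexp (y * r)" borel]
    by (intro indep_var_lebesgue_integral integrable_iexp_rv) (auto simp: comp_def)
  also have "\<dots> = of_real (exp (- ((x\<^sup>2 + y\<^sup>2) / 4)))"
    by (simp add: expectation_iexp_normal[OF R] expectation_iexp_normal[OF I] power_divide add_divide_distrib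
          flip: of_real_mult exp_add)
  finally show ?thesis .
qed

section \<open>Vectors with independent complex Gaussian entries: gain of an interferer and squared
  norm\<close>

lemma power2_norm_vec: "(norm (v :: complex ^ 'n))\<^sup>2 = (\<Sum>i\<in>UNIV. (cmod (v $ i))\<^sup>2)"
  by (simp add: norm_vec_def L2_set_def sum_nonneg)

text \<open>The inner product with a fixed \<open>v\<close> is a sum of independent terms, so its
  characteristic function is a product over the coordinates. The result is rotation invariant in (x,
  y), the form that \<open>expectation_exp_square_of_char\<close> expects, with (norm v)^2 / 4 as
  the constant.\<close>

lemma (in prob_space) hermitian_inner_iexp:
  fixes v :: "complex ^ 'n"
  assumes g: "iid_complex_gaussian_vector g"
  shows "(CLINT \<omega>|M. iexp (x * Re (hermitian_inner v (g \<omega>)) + y * Im (hermitian_inner v (g \<omega>))))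
    = of_real (exp (- ((norm v)\<^sup>2 / 4 * (x\<^sup>2 + y\<^sup>2))))"
proof -
  \<comment> \<open>\<open>?a i\<close> and \<open>?b i\<close> are the real and imaginary parts of
    (x + i y) v_i. Hence their squares add up to (x^2 + y^2) |v_i|^2.\<close>
  let ?a = "\<lambda>i. x * Re (v $ i) - y * Im (v $ i)" and ?b = "\<lambda>i. x * Im (v $ i) + y * Re (v $ i)"
  have G: "std_complex_gaussian (\<lambda>\<omega>. g \<omega> $ i)" for i
    using g by (simp add: iid_complex_gaussian_vector_def)
  have ind: "indep_vars (\<lambda>_. borel) (\<lambda>i \<omega>. g \<omega> $ i) UNIV"
    using g by (simp add: iid_complex_gaussian_vector_def)
  have [measurable]: "(\<lambda>\<omega>. g \<omega> $ i) \<in> borel_measurable M" for i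
    using ind by (simp add: indep_vars_def)
  have "x * Re (hermitian_inner v w) + y * Im (hermitian_inner v w)
     = (\<Sum>i\<in>UNIV. ?a i * Re (w $ i) + ?b i * Im (w $ i))" for w
    by (simp add: hermitian_inner_def sum_distrib_left algebra_simps sum.distrib sum_subtractf sum_negf)
  then have "(CLINT \<omega>|M. iexp (x * Re (hermitian_inner v (g \<omega>)) + y * Im (hermitian_inner v (g \<omega>))))
     = (CLINT \<omega>|M. (\<Prod>i\<in>UNIV. iexp (?a i * Re (g \<omega> $ i) + ?b i * Im (g \<omega> $ i))))"
    by (simp only: of_real_sum sum_distrib_left exp_sum finite)
  also have "\<dots> = (\<Prod>i\<in>UNIV. CLINT \<omega>|M. iexp (?a i * Re (g \<omega> $ i) + ?b i * Im (g \<omega> $ i)))"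
  proof (rule indep_vars_lebesgue_integral)
    show "indep_vars (\<lambda>_. borel) (\<lambda>i \<omega>. iexp (?a i * Re (g \<omega> $ i) + ?b i * Im (g \<omega> $ i))) UNIV"
      by (rule indep_vars_compose2[OF ind, of "\<lambda>i z. iexp (?a i * Re z + ?b i * Im z)"]) auto
  qed (simp, rule integrable_iexp_rv, measurable)
  also have "\<dots> = (\<Prod>i\<in>UNIV. of_real (exp (- (((?a i)\<^sup>2 + (?b i)\<^sup>2) / 4))))"
    by (simp only: std_complex_gaussian_iexp[OF G])
  also have "\<dots> = of_real (exp (\<Sum>i\<in>UNIV. - (((?a i)\<^sup>2 + (?b i)\<^sup>2) / 4)))"
    by (simp add: exp_sum)
  also have "(\<Sum>i\<in>UNIV. - (((?a i)\<^sup>2 + (?b i)\<^sup>2) / 4)) = - ((norm v)\<^sup>2 / 4 * (x\<^sup>2 + y\<^sup>2))"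
  proof -
    have eq: "- (((?a i)\<^sup>2 + (?b i)\<^sup>2) / 4) = - ((x\<^sup>2 + y\<^sup>2) / 4) * (cmod (v $ i))\<^sup>2" for i
      unfolding cmod_power2 by algebra
    show ?thesis
      unfolding eq sum_distrib_left[symmetric] power2_norm_vec by simp
  qed
  finally show ?thesis .
qed

text \<open>Dividing by (norm v)^2 cancels the variance of the inner product, so the answer is the
  transform of a standard exponential for every \<open>v\<close>. This independence of
  \<open>v\<close> is what later separates the interference from the direct fading. For
  \<open>v = 0\<close> the quotient in the gain is 0 by convention and the identity fails.\<close>

lemma (in prob_space) expectation_interferer_gain:
  fixes v :: "complex ^ 'n"
  assumes g: "iid_complex_gaussian_vector g" and v: "v \<noteq> 0" and t: "t \<ge> 0"
  shows "(\<integral>\<^sup>+\<omega>. ennreal (exp (- (t * interferer_gain v (g \<omega>)))) \<partial>M) = ennreal (1 / (1 + t))"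
proof (cases "t = 0")
  case False
  have [measurable]: "(\<lambda>\<omega>. g \<omega> $ i) \<in> borel_measurable M" for i
    using g by (simp add: iid_complex_gaussian_vector_def indep_vars_def)
  have [measurable]: "(\<lambda>\<omega>. hermitian_inner v (g \<omega>)) \<in> borel_measurable M"
    unfolding hermitian_inner_def by measurable
  have "(\<integral>\<^sup>+\<omega>. ennreal (exp (- (t * interferer_gain v (g \<omega>)))) \<partial>M)
      = ennreal (expectation (\<lambda>\<omega>. exp (- (t * interferer_gain v (g \<omega>)))))"
    using t by (intro nn_integral_eq_integral integrable_const_bound[where B = 1])
       (auto simp: interferer_gain_def)
  also have "expectation (\<lambda>\<omega>. exp (- (t * interferer_gain v (g \<omega>))))
     = expectation (\<lambda>\<omega>. exp (- (t / (norm v)\<^sup>2 * ((Re (hermitian_inner v (g \<omega>)))\<^sup>2 + (Im (hermitian_inner v (g \<omega>)))\<^sup>2))))"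
    by (simp add: interferer_gain_def cmod_power2)
  also have "\<dots> = 1 / (1 + 4 * ((norm v)\<^sup>2 / 4) * (t / (norm v)\<^sup>2))"
    using hermitian_inner_iexp[OF g, of _ v] t v False
    by (intro expectation_exp_square_of_char) auto
  finally show ?thesis using v by simp
qed (simp add: emeasure_space_1)

lemma (in prob_space) expectation_exp_norm_square:
  fixes g :: "'a \<Rightarrow> complex ^ 'n"
  assumes g: "iid_complex_gaussian_vector g" and t: "t \<ge> 0"
  shows "(\<integral>\<^sup>+\<omega>. ennreal (exp (- (t * (norm (g \<omega>))\<^sup>2))) \<partial>M) = ennreal (1 / (1 + t) ^ CARD('n))"
proof -
  have G: "std_complex_gaussian (\<lambda>\<omega>. g \<omega> $ i)" for i
    using g by (simp add: iid_complex_gaussian_vector_def)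
  have ind: "indep_vars (\<lambda>_. borel) (\<lambda>i \<omega>. g \<omega> $ i) UNIV"
    using g by (simp add: iid_complex_gaussian_vector_def)
  have [measurable]: "(\<lambda>\<omega>. g \<omega> $ i) \<in> borel_measurable M" for i
    using ind by (simp add: indep_vars_def)
  have one: "expectation (\<lambda>\<omega>. exp (- (t * (cmod (g \<omega> $ i))\<^sup>2))) = 1 / (1 + t)" for i
  proof (cases "t = 0")
    case False
    then show ?thesis
      using std_complex_gaussian_iexp[OF G, of _ i] t
      by (subst cmod_power2, subst expectation_exp_square_of_char[where \<kappa> = "1/4"]) auto
  qed (simp add: prob_space)
  have "(\<integral>\<^sup>+\<omega>. ennreal (exp (- (t * (norm (g \<omega>))\<^sup>2))) \<partial>M) = (\<integral>\<^sup>+\<omega>. ennreal (\<Prod>i\<in>UNIV. exp (- (t * (cmod (g \<omega> $ i))\<^sup>2))) \<partial>M)"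
    by (simp add: power2_norm_vec sum_distrib_left exp_sum flip: sum_negf)
  also have "\<dots> = ennreal (expectation (\<lambda>\<omega>. \<Prod>i\<in>UNIV. exp (- (t * (cmod (g \<omega> $ i))\<^sup>2))))"
    using t by (intro nn_integral_eq_integral integrable_const_bound[where B = 1])
       (auto simp: prod_nonneg intro!: prod_le_1)
  also have "expectation (\<lambda>\<omega>. \<Prod>i\<in>UNIV. exp (- (t * (cmod (g \<omega> $ i))\<^sup>2)))
     = (\<Prod>i\<in>UNIV. expectation (\<lambda>\<omega>. exp (- (t * (cmod (g \<omega> $ i))\<^sup>2))))"
  proof (rule indep_vars_lebesgue_integral)
    show "indep_vars (\<lambda>_. borel) (\<lambda>i \<omega>. exp (- (t * (cmod (g \<omega> $ i))\<^sup>2))) UNIV"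
      by (rule indep_vars_compose2[OF ind, of "\<lambda>i z. exp (- (t * (cmod z)\<^sup>2))"]) auto
  qed (use t in \<open>auto intro!: integrable_const_bound[where B = 1]\<close>)
  also have "\<dots> = 1 / (1 + t) ^ CARD('n)"
    by (simp add: one power_divide)
  finally show ?thesis .
qed

text \<open>The indicator of the event g = 0 is bounded by exp (- t (norm g)^2) for every t >= 0,
  and the expectation of the latter tends to 0 as t grows.\<close>

lemma (in prob_space) AE_complex_gaussian_nonzero:
  fixes g :: "'a \<Rightarrow> complex ^ 'n"
  assumes g: "iid_complex_gaussian_vector g" and [measurable]: "g \<in> borel_measurable M"
  shows "AE \<omega> in M. g \<omega> \<noteq> 0"
proof -
  have le: "prob {\<omega> \<in> space M. g \<omega> = 0} \<le> 1 / (1 + t) ^ CARD('n)" if "t \<ge> 0" for t :: real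
  proof -
    have "ennreal (prob {\<omega> \<in> space M. g \<omega> = 0}) = (\<integral>\<^sup>+\<omega>. indicator {\<omega> \<in> space M. g \<omega> = 0} \<omega> \<partial>M)"
      by (simp add: emeasure_eq_measure)
    also have "\<dots> \<le> (\<integral>\<^sup>+\<omega>. ennreal (exp (- (t * (norm (g \<omega>))\<^sup>2))) \<partial>M)"
      by (intro nn_integral_mono) (auto simp: indicator_def)
    also have "\<dots> = ennreal (1 / (1 + t) ^ CARD('n))"
      by (rule expectation_exp_norm_square[OF g that])
    finally show ?thesis using that by (subst (asm) ennreal_le_iff) auto
  qed
  have "((\<lambda>t::real. 1 / (1 + t) ^ CARD('n)) \<longlongrightarrow> 0) at_top"
    by real_asymp
  then have "prob {\<omega> \<in> space M. g \<omega> = 0} \<le> 0"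
    by (rule tendsto_lowerbound) (auto simp: eventually_at_top_linorder intro!: exI[of _ 0] le)
  then have "prob {\<omega> \<in> space M. g \<omega> = 0} = 0" by (simp add: measure_le_0_iff)
  then show ?thesis
    by (subst AE_iff_measurable[OF _ refl]) (auto simp: emeasure_eq_measure)
qed

subsection \<open>The Laplace functional of a Poisson process\<close>

text \<open>The continuous multiplicative extension of exp (- x) to [0, infinity]. The value at
  \<open>\<top>\<close> is set separately because \<open>enn2real \<top>\<close> is 0, which would
  give 1 there.\<close>

definition exp_neg :: "ennreal \<Rightarrow> real" where
  "exp_neg x = (if x = \<top> then 0 else exp (- enn2real x))"

lemma exp_neg_ennreal [simp]: "0 \<le> a \<Longrightarrow> exp_neg (ennreal a) = exp (- a)"
  by (simp add: exp_neg_def)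

lemma exp_neg_top [simp]: "exp_neg \<top> = 0"
  by (simp add: exp_neg_def)

lemma exp_neg_0 [simp]: "exp_neg 0 = 1"
  by (simp add: exp_neg_def)

lemma exp_neg_nonneg [simp]: "0 \<le> exp_neg x"
  by (simp add: exp_neg_def)

lemma exp_neg_le_1 [simp]: "exp_neg x \<le> 1"
  by (simp add: exp_neg_def)

lemma exp_neg_add: "exp_neg (x + y) = exp_neg x * exp_neg y"
  by (cases x; cases y) (simp_all flip: ennreal_plus add: exp_add[symmetric])

lemma exp_neg_sum: "finite A \<Longrightarrow> exp_neg (sum f A) = (\<Prod>i\<in>A. exp_neg (f i))"
  by (induction A rule: finite_induct) (simp_all add: exp_neg_add)

lemma borel_measurable_exp_neg [measurable]: "exp_neg \<in> borel_measurable borel"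
  unfolding exp_neg_def by measurable

lemma exp_neg_mono: "x \<le> y \<Longrightarrow> exp_neg y \<le> exp_neg x"
  by (cases x; cases y) (auto simp: top_unique)

lemma tendsto_exp_neg:
  assumes "(f \<longlongrightarrow> x) F"
  shows "((\<lambda>i. exp_neg (f i)) \<longlongrightarrow> exp_neg x) F"
proof (cases x)
  case (real r)
  have "((\<lambda>i. enn2real (f i)) \<longlongrightarrow> r) F"
    using assms unfolding real by (rule tendsto_enn2real) (rule real)
  then have "((\<lambda>i. exp (- enn2real (f i))) \<longlongrightarrow> exp (- r)) F"
    by (intro tendsto_exp tendsto_minus)
  moreover have "eventually (\<lambda>i. f i < \<top>) F"
    using assms real by (intro order_tendstoD) auto
  then have "eventually (\<lambda>i. exp (- enn2real (f i)) = exp_neg (f i)) F"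
    by eventually_elim (simp add: exp_neg_def)
  ultimately show ?thesis
    using real by (auto intro: Lim_transform_eventually)
next
  case top
  show ?thesis
    unfolding tendsto_iff
  proof safe
    fix e :: real assume "e > 0"
    \<comment> \<open>\<open>- ln e + 1\<close> makes exp (- r) smaller than e; the maximum with 1
      keeps r nonnegative, so that \<open>exp_neg (ennreal r)\<close> is exp (- r).\<close>
    define r where "r = max 1 (- ln e + 1)"
    have "exp (- r) < e"
    proof -
      have "- r < ln e" by (simp add: r_def)
      then show ?thesis using \<open>e > 0\<close> by (metis exp_less_cancel_iff exp_ln)
    qed
    have "eventually (\<lambda>i. f i > ennreal r) F"
      using assms top by (intro order_tendstoD) auto
    then show "eventually (\<lambda>i. dist (exp_neg (f i)) (exp_neg x) < e) F"
    proof eventually_elim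
      case (elim i)
      then have "exp_neg (f i) \<le> exp (- r)"
        using exp_neg_mono[of "ennreal r" "f i"] by (simp add: r_def)
      then show ?case using \<open>exp (- r) < e\<close> top by simp
    qed
  qed
qed

lemma exp_neg_suminf: "(\<lambda>n. \<Prod>l<n. exp_neg (f l)) \<longlonglongrightarrow> exp_neg (\<Sum>l. f l)"
  unfolding exp_neg_sum[OF finite_lessThan, symmetric]
  by (intro tendsto_exp_neg summable_LIMSEQ) simp

text \<open>Only the masses at the natural numbers are given. They sum to 1, so other values,
  including infinity, have probability 0, and the expectation is the probability generating function
  at \<open>exp_neg a\<close>.\<close>

lemma (in prob_space) poisson_laplace:
  fixes N :: "'a \<Rightarrow> ennreal"
  assumes [measurable]: "N \<in> borel_measurable M" and \<mu>: "\<mu> \<ge> 0" and a: "a < \<top>"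
    and N: "\<And>k::nat. prob {\<omega> \<in> space M. N \<omega> = of_nat k} = \<mu> ^ k / fact k * exp (- \<mu>)"
  shows "expectation (\<lambda>\<omega>. exp_neg (a * N \<omega>)) = exp (- (\<mu> * (1 - exp_neg a)))"
proof -
  obtain r where r: "a = ennreal r" "r \<ge> 0" using a by (cases a) auto
  define A where "A k = {\<omega> \<in> space M. N \<omega> = of_nat k}" for k :: nat
  have [measurable]: "A k \<in> sets M" for k unfolding A_def by measurable
  have disj: "disjoint_family A" by (auto simp: disjoint_family_on_def A_def)
  \<comment> \<open>Used twice: x = 1 shows that the events \<open>A k\<close> exhaust the space
    almost surely, x = exp (- r) gives the expectation.\<close>
  have gen: "(\<Sum>k. ennreal (x ^ k) * emeasure M (A k)) = ennreal (exp (- (\<mu> * (1 - x))))" if x: "0 \<le> x" for x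
  proof -
    have "(\<lambda>k. ((x * \<mu>) ^ k /\<^sub>R fact k) * exp (- \<mu>)) sums (exp (x * \<mu>) * exp (- \<mu>))"
      by (intro sums_mult2 exp_converges)
    then have "(\<lambda>k. x ^ k * (\<mu> ^ k / fact k * exp (- \<mu>))) sums exp (- (\<mu> * (1 - x)))"
      by (simp add: exp_add[symmetric] algebra_simps power_mult_distrib divide_inverse)
    then have "(\<Sum>k. ennreal (x ^ k * (\<mu> ^ k / fact k * exp (- \<mu>)))) = ennreal (exp (- (\<mu> * (1 - x))))"
      using x \<mu> by (intro suminf_ennreal_eq) auto
    then show ?thesis
      using x by (simp add: emeasure_eq_measure A_def N ennreal_mult'[symmetric])
  qed
  have "emeasure M (\<Union>k. A k) = 1"
    using gen[of 1] suminf_emeasure[of A M] disj by (simp add: image_subset_iff)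
  then have "AE \<omega> in M. \<omega> \<in> (\<Union>k. A k)"
    by (intro AE_prob_1) (simp add: measure_def)
  then have AE: "AE \<omega> in M. ennreal (exp_neg (a * N \<omega>)) = (\<Sum>k. ennreal (exp (- r) ^ k) * indicator (A k) \<omega>)"
  proof eventually_elim
    case (elim \<omega>)
    then obtain k where k: "\<omega> \<in> A k" by auto
    then have "(\<Sum>k. ennreal (exp (- r) ^ k) * indicator (A k) \<omega>) = (\<Sum>j\<in>{k}. ennreal (exp (- r) ^ j) * indicator (A j) \<omega>)"
      using disj by (intro suminf_finite) (auto simp: A_def indicator_def)
    also have "\<dots> = ennreal (exp_neg (a * N \<omega>))"
      using k r by (simp add: A_def exp_of_nat_mult[symmetric] mult.commute ennreal_of_nat_eq_real_of_nat flip: ennreal_mult)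
    finally show ?case by simp
  qed
  have "ennreal (expectation (\<lambda>\<omega>. exp_neg (a * N \<omega>))) = (\<integral>\<^sup>+\<omega>. ennreal (exp_neg (a * N \<omega>)) \<partial>M)"
    by (intro nn_integral_eq_integral[symmetric] integrable_const_bound[where B = 1]) auto
  also have "\<dots> = (\<integral>\<^sup>+\<omega>. (\<Sum>k. ennreal (exp (- r) ^ k) * indicator (A k) \<omega>) \<partial>M)"
    by (rule nn_integral_cong_AE[OF AE])
  also have "\<dots> = (\<Sum>k. ennreal (exp (- r) ^ k) * emeasure M (A k))"
    by (subst nn_integral_suminf) (auto simp: nn_integral_cmult)
  also have "\<dots> = ennreal (exp (- (\<mu> * (1 - exp_neg a))))"
    using r by (simp add: gen)
  finally show ?thesis by (subst (asm) ennreal_inj) auto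
qed

section \<open>From Poisson counts to the Laplace functional of the process\<close>

lemma borel_measurable_point_count [measurable]:
  assumes "\<And>l. X l \<in> borel_measurable M" "A \<in> sets borel"
  shows "point_count X A \<in> borel_measurable M"
proof -
  note assms[measurable]
  show ?thesis unfolding point_count_def by measurable
qed

text \<open>The sum over the points is a finite combination of the counts of the level sets of
  \<open>f\<close>. These sets are disjoint, so the counts are independent Poisson variables and the
  expectation factors. The finiteness conditions on \<open>f\<close> put each level set and each
  coefficient within reach of \<open>homogeneous_ppp\<close> and
  \<open>poisson_laplace\<close>.\<close>

lemma (in prob_space) ppp_laplace_functional_simple:
  fixes X :: "nat \<Rightarrow> 'a \<Rightarrow> 'b::euclidean_space"
  assumes ppp: "homogeneous_ppp lam X" and lam: "lam \<ge> 0"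
    and f: "simple_function borel f" "\<And>x. f x < \<top>"
    and fin: "emeasure lborel {x. f x \<noteq> 0} < \<infinity>"
  shows "expectation (\<lambda>\<omega>. exp_neg (\<Sum>l. f (X l \<omega>)))
    = exp_neg (ennreal lam * (\<integral>\<^sup>+x. ennreal (1 - exp_neg (f x)) \<partial>lborel))"
proof -
  define R where "R = range f - {0}"
  have fm[measurable]: "f \<in> borel_measurable borel" using f(1) by (rule borel_measurable_simple_function)
  have X[measurable]: "X l \<in> borel_measurable M" for l
    using ppp by (simp add: homogeneous_ppp_def)
  have "finite R" using f(1) by (simp add: R_def simple_function_def)
  then obtain e where e: "bij_betw e {..<card R} R"
    using bij_betw_from_nat_into_finite by blast
  define m where "m = card R"
  \<comment> \<open>Independence in \<open>homogeneous_ppp\<close> is stated for infinite sequences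
    of disjoint sets; the finite list of level sets is padded with empty ones.\<close>
  define A where "A i = (if i < m then f -` {e i} else {})" for i
  have eR: "e i \<in> R" if "i < m" for i using e that by (auto simp: bij_betw_def m_def)
  have inj: "e i = e j \<Longrightarrow> i < m \<Longrightarrow> j < m \<Longrightarrow> i = j" for i j
    using e by (auto simp: bij_betw_def m_def inj_on_def)
  have surj: "f x \<noteq> 0 \<Longrightarrow> \<exists>i<m. f x = e i" for x
    using e by (auto simp: bij_betw_def m_def R_def image_iff set_eq_iff)
  have [measurable]: "A i \<in> sets borel" for i
    using measurable_sets[OF fm, of "{e i}"] by (auto simp: A_def)
  have Afin: "emeasure lborel (A i) < \<infinity>" for i
  proof -
    have "emeasure lborel (A i) \<le> emeasure lborel {x. f x \<noteq> 0}"
      using eR[of i] by (intro emeasure_mono) (auto simp: A_def R_def)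
    then show ?thesis using fin by (rule le_less_trans)
  qed
  have disj: "disjoint_family A"
    using inj by (auto simp: disjoint_family_on_def A_def)
  \<comment> \<open>Taking \<open>F\<close> as the identity expresses the sum over the points by
    counts; taking 1 - \<open>exp_neg\<close> gives the integral on the right-hand side.\<close>
  have rep: "F (f x) = (\<Sum>i<m. F (e i) * indicator (A i) x)" if "F 0 = 0" for F :: "ennreal \<Rightarrow> ennreal" and x
  proof (cases "f x = 0")
    case True
    then have "\<forall>i<m. x \<notin> A i" using eR by (auto simp: A_def R_def)
    then show ?thesis using True that by (auto intro!: sum.neutral[symmetric])
  next
    case False
    then obtain i where i: "i < m" "f x = e i" using surj by blast
    have "(\<Sum>j<m. F (e j) * indicator (A j) x) = (\<Sum>j\<in>{i}. F (e j) * indicator (A j) x)"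
      using i inj by (intro sum.mono_neutral_right) (auto simp: A_def indicator_def)
    then show ?thesis using i by (simp add: A_def)
  qed
  define N where "N i = point_count X (A i)" for i
  have Nm[measurable]: "N i \<in> borel_measurable M" for i unfolding N_def by measurable
  have "(\<Sum>l. f (X l \<omega>)) = (\<Sum>i<m. e i * N i \<omega>)" for \<omega>
  proof -
    have "(\<Sum>l. f (X l \<omega>)) = (\<Sum>l. \<Sum>i<m. e i * indicator (A i) (X l \<omega>))"
      using rep[of "\<lambda>c. c"] by simp
    also have "\<dots> = (\<Sum>i<m. e i * N i \<omega>)"
      by (subst suminf_sum) (auto simp: N_def point_count_def)
    finally show ?thesis .
  qed
  then have "expectation (\<lambda>\<omega>. exp_neg (\<Sum>l. f (X l \<omega>))) = expectation (\<lambda>\<omega>. \<Prod>i<m. exp_neg (e i * N i \<omega>))"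
    by (simp add: exp_neg_sum)
  also have "\<dots> = (\<Prod>i<m. expectation (\<lambda>\<omega>. exp_neg (e i * N i \<omega>)))"
  proof (rule indep_vars_lebesgue_integral)
    have "indep_vars (\<lambda>_. borel) N UNIV"
      using ppp disj Afin unfolding homogeneous_ppp_def N_def by auto
    then have "indep_vars (\<lambda>_. borel) N {..<m}" by (rule indep_vars_subset) simp
    then show "indep_vars (\<lambda>_. borel) (\<lambda>i \<omega>. exp_neg (e i * N i \<omega>)) {..<m}"
      by (rule indep_vars_compose2[of _ _ _ "\<lambda>i n. exp_neg (e i * n)"]) measurable
  qed (auto intro!: integrable_const_bound[where B = 1])
  also have "\<dots> = (\<Prod>i<m. exp_neg (ennreal lam * (ennreal (1 - exp_neg (e i)) * emeasure lborel (A i))))"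
  proof (intro prod.cong refl)
    fix i assume "i \<in> {..<m}"
    then have i: "e i < \<top>" using f(2) eR[of i] by (auto simp: R_def)
    have "expectation (\<lambda>\<omega>. exp_neg (e i * N i \<omega>)) = exp (- (lam * measure lborel (A i) * (1 - exp_neg (e i))))"
      using ppp Afin[of i] lam unfolding homogeneous_ppp_def N_def
      by (intro poisson_laplace i) auto
    also have "\<dots> = exp_neg (ennreal (lam * measure lborel (A i) * (1 - exp_neg (e i))))"
      using lam by simp
    also have "ennreal (lam * measure lborel (A i) * (1 - exp_neg (e i)))
        = ennreal lam * (ennreal (1 - exp_neg (e i)) * emeasure lborel (A i))"
      using lam Afin[of i] by (simp add: emeasure_eq_ennreal_measure ennreal_mult mult_ac)
    finally show "expectation (\<lambda>\<omega>. exp_neg (e i * N i \<omega>))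
        = exp_neg (ennreal lam * (ennreal (1 - exp_neg (e i)) * emeasure lborel (A i)))" .
  qed
  also have "\<dots> = exp_neg (ennreal lam * (\<Sum>i<m. ennreal (1 - exp_neg (e i)) * emeasure lborel (A i)))"
    by (simp add: exp_neg_sum sum_distrib_left)
  also have "(\<Sum>i<m. ennreal (1 - exp_neg (e i)) * emeasure lborel (A i))
      = (\<integral>\<^sup>+x. ennreal (1 - exp_neg (f x)) \<partial>lborel)"
    by (subst rep[of "\<lambda>c. ennreal (1 - exp_neg c)"])
       (simp_all add: nn_integral_sum nn_integral_cmult del: sum_mult_indicator sum_ennreal)
  finally show ?thesis .
qed

text \<open>Both sides pass to the limit along increasing simple functions: the left by dominated
  convergence, the right by monotone convergence, because 1 - \<open>exp_neg\<close> is
  increasing.\<close>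

lemma (in prob_space) ppp_laplace_functional:
  fixes X :: "nat \<Rightarrow> 'a \<Rightarrow> 'b::euclidean_space"
  assumes ppp: "homogeneous_ppp lam X" and lam: "lam \<ge> 0"
    and f[measurable]: "f \<in> borel_measurable borel"
  shows "expectation (\<lambda>\<omega>. exp_neg (\<Sum>l. f (X l \<omega>)))
    = exp_neg (ennreal lam * (\<integral>\<^sup>+x. ennreal (1 - exp_neg (f x)) \<partial>lborel))"
proof -
  have X[measurable]: "X l \<in> borel_measurable M" for l
    using ppp by (simp add: homogeneous_ppp_def)
  obtain s where s: "\<And>i. simple_function borel (s i)" "incseq s" "\<And>i x. s i x < \<top>" "\<And>x. (SUP i. s i x) = f x"
    using borel_measurable_implies_simple_function_sequence'[OF f] by metis
  \<comment> \<open>Cutting off at radius i gives the simple functions a support of finite measure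
    while keeping the sequence increasing with limit \<open>f\<close>.\<close>
  define g where "g i x = s i x * indicator (ball 0 (real i)) x" for i x
  have g_simple: "simple_function borel (g i)" for i
    unfolding g_def by (intro simple_function_mult s simple_function_indicator) auto
  have [measurable]: "g i \<in> borel_measurable borel" for i
    using g_simple by (rule borel_measurable_simple_function)
  have g_inc: "incseq g"
    unfolding incseq_def le_fun_def g_def
  proof safe
    fix m n :: nat and x assume "m \<le> n"
    then show "s m x * indicator (ball 0 (real m)) x \<le> s n x * indicator (ball 0 (real n)) x"
      using s(2) by (intro mult_mono) (auto simp: incseq_def le_fun_def indicator_def)
  qed
  have g_lim: "(\<lambda>i. g i x) \<longlonglongrightarrow> f x" for x
  proof -
    have "(\<lambda>i. s i x) \<longlonglongrightarrow> f x"
      using s(2) s(4)[of x] LIMSEQ_SUP[of "\<lambda>i. s i x"] by (simp add: incseq_def le_fun_def)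
    moreover have "eventually (\<lambda>i. s i x = g i x) sequentially"
      using eventually_gt_at_top[of "nat \<lceil>norm x\<rceil>"]
    proof eventually_elim
      case (elim i)
      then have "norm x < real i" by linarith
      then show ?case by (simp add: g_def)
    qed
    ultimately show ?thesis by (rule Lim_transform_eventually)
  qed
  have g_sup: "(SUP i. g i x) = f x" for x
    using g_inc by (intro LIMSEQ_unique[OF LIMSEQ_SUP g_lim]) (simp add: incseq_def le_fun_def)
  have "(\<lambda>i. expectation (\<lambda>\<omega>. exp_neg (\<Sum>l. g i (X l \<omega>)))) \<longlonglongrightarrow> expectation (\<lambda>\<omega>. exp_neg (\<Sum>l. f (X l \<omega>)))"
  proof (rule integral_dominated_convergence[where w = "\<lambda>_. 1"])
    show "AE \<omega> in M. (\<lambda>i. exp_neg (\<Sum>l. g i (X l \<omega>))) \<longlonglongrightarrow> exp_neg (\<Sum>l. f (X l \<omega>))"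
    proof (intro AE_I2 tendsto_exp_neg)
      fix \<omega>
      have "(\<Sum>l. SUP i. g i (X l \<omega>)) = (SUP i. \<Sum>l. g i (X l \<omega>))"
        using g_inc by (intro ennreal_suminf_SUP_eq) (simp add: incseq_def le_fun_def)
      then have "(\<Sum>l. f (X l \<omega>)) = (SUP i. \<Sum>l. g i (X l \<omega>))"
        by (simp add: g_sup)
      moreover have "incseq (\<lambda>i. \<Sum>l. g i (X l \<omega>))"
        using g_inc by (auto simp: incseq_def le_fun_def intro!: suminf_le)
      ultimately show "(\<lambda>i. \<Sum>l. g i (X l \<omega>)) \<longlonglongrightarrow> (\<Sum>l. f (X l \<omega>))"
        using LIMSEQ_SUP by metis
    qed
  qed auto
  moreover have "expectation (\<lambda>\<omega>. exp_neg (\<Sum>l. g i (X l \<omega>)))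
      = exp_neg (ennreal lam * (\<integral>\<^sup>+x. ennreal (1 - exp_neg (g i x)) \<partial>lborel))" for i
  proof (rule ppp_laplace_functional_simple[OF ppp lam g_simple])
    show "g i x < \<top>" for x using s(3)[of i x] by (simp add: g_def indicator_def)
    have "emeasure lborel {x. g i x \<noteq> 0} \<le> emeasure lborel (ball (0::'b) (real i))"
      by (intro emeasure_mono) (auto simp: g_def indicator_def split: if_splits)
    also have "\<dots> < \<infinity>" by (rule emeasure_bounded_finite) simp
    finally show "emeasure lborel {x. g i x \<noteq> 0} < \<infinity>" .
  qed
  moreover have "(\<lambda>i. exp_neg (ennreal lam * (\<integral>\<^sup>+x. ennreal (1 - exp_neg (g i x)) \<partial>lborel)))
      \<longlonglongrightarrow> exp_neg (ennreal lam * (\<integral>\<^sup>+x. ennreal (1 - exp_neg (f x)) \<partial>lborel))"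
  proof (intro tendsto_exp_neg ennreal_tendsto_cmult nn_integral_LIMSEQ)
    show "incseq (\<lambda>i x. ennreal (1 - exp_neg (g i x)))"
      using g_inc by (auto simp: incseq_def le_fun_def intro!: ennreal_leI exp_neg_mono)
    show "(\<lambda>i. ennreal (1 - exp_neg (g i x))) \<longlonglongrightarrow> ennreal (1 - exp_neg (f x))" for x
      by (intro tendsto_ennrealI tendsto_intros tendsto_exp_neg g_lim)
  qed auto
  ultimately show ?thesis by (simp add: LIMSEQ_unique)
qed

subsection \<open>Independence of the sources\<close>

text \<open>Conditioning on \<open>Y\<close> without conditional expectations: \<open>Z\<close> is
  replaced by an independent copy, and \<open>Y\<close> is a constant in the inner integral.\<close>

lemma (in prob_space) nn_integral_indep_var:
  assumes ind: "indep_var S Y T Z" and f[measurable]: "f \<in> borel_measurable (S \<Otimes>\<^sub>M T)"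
  shows "(\<integral>\<^sup>+\<omega>. f (Y \<omega>, Z \<omega>) \<partial>M) = (\<integral>\<^sup>+\<omega>. (\<integral>\<^sup>+\<omega>'. f (Y \<omega>, Z \<omega>') \<partial>M) \<partial>M)"
proof -
  have [measurable]: "Y \<in> M \<rightarrow>\<^sub>M S" "Z \<in> M \<rightarrow>\<^sub>M T"
    using ind by (auto dest: indep_var_rv1 indep_var_rv2)
  interpret Y: prob_space "distr M S Y" by (rule prob_space_distr) measurable
  interpret Z: prob_space "distr M T Z" by (rule prob_space_distr) measurable
  have "(\<integral>\<^sup>+\<omega>. f (Y \<omega>, Z \<omega>) \<partial>M) = (\<integral>\<^sup>+p. f p \<partial>distr M (S \<Otimes>\<^sub>M T) (\<lambda>\<omega>. (Y \<omega>, Z \<omega>)))"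
    by (subst nn_integral_distr) auto
  also have "\<dots> = (\<integral>\<^sup>+p. f p \<partial>(distr M S Y \<Otimes>\<^sub>M distr M T Z))"
    using ind by (simp add: indep_var_distribution_eq)
  also have "\<dots> = (\<integral>\<^sup>+y. (\<integral>\<^sup>+z. f (y, z) \<partial>distr M T Z) \<partial>distr M S Y)"
    by (rule Z.nn_integral_fst[symmetric]) measurable
  also have "\<dots> = (\<integral>\<^sup>+\<omega>. (\<integral>\<^sup>+z. f (Y \<omega>, z) \<partial>distr M T Z) \<partial>M)"
    by (rule nn_integral_distr) measurable
  also have "\<dots> = (\<integral>\<^sup>+\<omega>. (\<integral>\<^sup>+\<omega>'. f (Y \<omega>, Z \<omega>') \<partial>M) \<partial>M)"
    by (intro nn_integral_cong nn_integral_distr measurable_Pair2[OF f])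
       (auto dest: measurable_space[of Y])
  finally show ?thesis .
qed

lemma borel_measurable_vec_nth [measurable]:
  "(\<lambda>v::'b::topological_space ^ 'n. v $ i) \<in> borel_measurable borel"
  by (intro borel_measurable_continuous_onI continuous_intros)

lemma borel_measurable_interferer_gain [measurable (raw)]:
  fixes f g :: "'a \<Rightarrow> complex ^ 'n"
  assumes [measurable]: "f \<in> borel_measurable M" "g \<in> borel_measurable M"
  shows "(\<lambda>x. interferer_gain (f x) (g x)) \<in> borel_measurable M"
proof -
  have [measurable]: "(\<lambda>x. f x $ i) \<in> borel_measurable M" "(\<lambda>x. g x $ i) \<in> borel_measurable M" for i
    by (rule measurable_compose[OF _ borel_measurable_vec_nth]; measurable)+
  have [measurable]: "(\<lambda>x. cnj (f x $ i)) \<in> borel_measurable M" for i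
    by (rule measurable_compose[OF _ borel_measurable_continuous_onI]) (auto intro!: continuous_intros)
  show ?thesis unfolding interferer_gain_def hermitian_inner_def by measurable
qed

lemma interferer_gain_nonneg [simp]: "0 \<le> interferer_gain v w"
  by (simp add: interferer_gain_def)

context typical_link
begin

abbreviation positions_space :: "(nat \<Rightarrow> real ^ 2) measure" where
  "positions_space \<equiv> \<Pi>\<^sub>M l\<in>UNIV. borel"

text \<open>The sources have different types; independence of families is only available for a single
  value type, so every source is embedded into one product space.\<close>

abbreviation source_space :: "(real \<times> (nat \<Rightarrow> real ^ 2) \<times> (complex ^ 'n)) measure" where
  "source_space \<equiv> borel \<Otimes>\<^sub>M (positions_space \<Otimes>\<^sub>M borel)"

definition source_value :: "source \<Rightarrow> 'w \<Rightarrow> real \<times> (nat \<Rightarrow> real ^ 2) \<times> (complex ^ 'n)" where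
  "source_value s \<omega> = (case s of
      Direct_Distance \<Rightarrow> (d0 \<omega>, \<lambda>_. 0, 0)
    | Interferers \<Rightarrow> (0, \<lambda>l. X l \<omega>, 0)
    | Direct_Fading \<Rightarrow> (0, \<lambda>_. 0, h0 \<omega>)
    | Interferer_Fading l \<Rightarrow> (0, \<lambda>_. 0, h l \<omega>))"

lemma measurable_sources [measurable]:
  "d0 \<in> borel_measurable M" "X l \<in> borel_measurable M" "h0 \<in> borel_measurable M" "h l \<in> borel_measurable M"
  using distributed_measurable[OF direct_distance] interferers direct_fading_measurable
    interferer_fading_measurable by (auto simp: homogeneous_ppp_def)

text \<open>Each \<open>source_value s\<close> is a measurable function of the corresponding source,
  so its sigma-algebra is contained in the one that \<open>independence\<close> provides; shrinking
  the sigma-algebras preserves independence.\<close>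

lemma indep_sources: "indep_vars (\<lambda>_. source_space) source_value UNIV"
  unfolding indep_vars_def2
proof (intro conjI ballI)
  let ?F = "\<lambda>s. case s of
        Direct_Distance \<Rightarrow> sets (vimage_algebra (space M) d0 borel)
      | Interferers \<Rightarrow> sets (vimage_algebra (space M) (\<lambda>\<omega> l. X l \<omega>) positions_space)
      | Direct_Fading \<Rightarrow> sets (vimage_algebra (space M) h0 borel)
      | Interferer_Fading l \<Rightarrow> sets (vimage_algebra (space M) (h l) borel)"
  show "source_value s \<in> M \<rightarrow>\<^sub>M source_space" for s
    unfolding source_value_def
    by (cases s) (auto intro!: measurable_Pair measurable_PiM_single')
  show "indep_sets (\<lambda>s. {source_value s -` A \<inter> space M |A. A \<in> sets source_space}) UNIV"
  proof (rule indep_sets_mono_sets[OF independence])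
    fix s
    have sub: "{f -` A \<inter> space M |A. A \<in> sets source_space} \<subseteq> sets (vimage_algebra (space M) g N)"
      if g: "g \<in> space M \<rightarrow> space N" and k: "k \<in> N \<rightarrow>\<^sub>M source_space" and f: "f = (\<lambda>\<omega>. k (g \<omega>))"
      for f and g :: "'w \<Rightarrow> 'c" and N k
    proof -
      have "f \<in> vimage_algebra (space M) g N \<rightarrow>\<^sub>M source_space"
        unfolding f by (rule measurable_compose[OF measurable_vimage_algebra1[OF g] k])
      from measurable_sets[OF this] show ?thesis by auto
    qed
    show "{source_value s -` A \<inter> space M |A. A \<in> sets source_space} \<subseteq> ?F s"
    proof (cases s)
      case Direct_Distance
      show ?thesis
        unfolding Direct_Distance source.case
        by (rule sub[of _ _ "\<lambda>x. (x, \<lambda>_. 0, 0)"])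
           (auto simp: source_value_def fun_eq_iff space_PiM intro!: measurable_Pair measurable_PiM_single')
    next
      case Interferers
      show ?thesis
        unfolding Interferers source.case
        by (rule sub[of _ _ "\<lambda>x. (0, x, 0)"])
           (auto simp: source_value_def fun_eq_iff space_PiM intro!: measurable_Pair measurable_PiM_single')
    next
      case Direct_Fading
      show ?thesis
        unfolding Direct_Fading source.case
        by (rule sub[of _ _ "\<lambda>x. (0, \<lambda>_. 0, x)"])
           (auto simp: source_value_def fun_eq_iff space_PiM intro!: measurable_Pair measurable_PiM_single')
    next
      case (Interferer_Fading l)
      show ?thesis
        unfolding Interferer_Fading source.case
        by (rule sub[of _ _ "\<lambda>x. (0, \<lambda>_. 0, x)"])
           (auto simp: source_value_def fun_eq_iff space_PiM intro!: measurable_Pair measurable_PiM_single')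
    qed
  qed
qed

text \<open>The maps \<open>k\<close> and \<open>k'\<close> read the wanted variables off two
  disjoint blocks of sources. The next three lemmas are instances that average in turn over the
  interferer fading, the positions and the direct fading, with the remaining variables
  frozen.\<close>

lemma nn_integral_disjoint_sources:
  assumes AB: "A \<inter> B = {}"
    and [measurable]: "k \<in> PiM A (\<lambda>_. source_space) \<rightarrow>\<^sub>M S" "k' \<in> PiM B (\<lambda>_. source_space) \<rightarrow>\<^sub>M T"
      "f \<in> borel_measurable (S \<Otimes>\<^sub>M T)"
    and Y: "Y = (\<lambda>\<omega>. k (\<lambda>s\<in>A. source_value s \<omega>))"
    and Z: "Z = (\<lambda>\<omega>. k' (\<lambda>s\<in>B. source_value s \<omega>))"
  shows "(\<integral>\<^sup>+\<omega>. f (Y \<omega>, Z \<omega>) \<partial>M) = (\<integral>\<^sup>+\<omega>. (\<integral>\<^sup>+\<omega>'. f (Y \<omega>, Z \<omega>') \<partial>M) \<partial>M)"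
proof -
  have "(\<lambda>p. f (k (fst p), k' (snd p))) \<in> borel_measurable (PiM A (\<lambda>_. source_space) \<Otimes>\<^sub>M PiM B (\<lambda>_. source_space))"
    by measurable
  from nn_integral_indep_var[OF indep_var_restrict[OF indep_sources AB] this]
  show ?thesis unfolding Y Z by simp
qed

lemma nn_integral_interferer_fading:
  assumes "f \<in> borel_measurable ((borel \<Otimes>\<^sub>M (positions_space \<Otimes>\<^sub>M borel)) \<Otimes>\<^sub>M (\<Pi>\<^sub>M l\<in>UNIV. borel))"
  shows "(\<integral>\<^sup>+\<omega>. f ((d0 \<omega>, (\<lambda>l. X l \<omega>), h0 \<omega>), (\<lambda>l. h l \<omega>)) \<partial>M)
    = (\<integral>\<^sup>+\<omega>. (\<integral>\<^sup>+\<omega>'. f ((d0 \<omega>, (\<lambda>l. X l \<omega>), h0 \<omega>), (\<lambda>l. h l \<omega>')) \<partial>M) \<partial>M)"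
  by (rule nn_integral_disjoint_sources[where A = "{Direct_Distance, Interferers, Direct_Fading}"
        and B = "range Interferer_Fading"
        and k = "\<lambda>p. (fst (p Direct_Distance), fst (snd (p Interferers)), snd (snd (p Direct_Fading)))"
        and k' = "\<lambda>p l. snd (snd (p (Interferer_Fading l)))", OF _ _ _ assms])
     (auto simp: source_value_def intro!: measurable_Pair measurable_PiM_single')

lemma nn_integral_positions:
  assumes "f \<in> borel_measurable ((borel \<Otimes>\<^sub>M borel) \<Otimes>\<^sub>M positions_space)"
  shows "(\<integral>\<^sup>+\<omega>. f ((d0 \<omega>, h0 \<omega>), (\<lambda>l. X l \<omega>)) \<partial>M)
    = (\<integral>\<^sup>+\<omega>. (\<integral>\<^sup>+\<omega>'. f ((d0 \<omega>, h0 \<omega>), (\<lambda>l. X l \<omega>')) \<partial>M) \<partial>M)"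
  by (rule nn_integral_disjoint_sources[where A = "{Direct_Distance, Direct_Fading}" and B = "{Interferers}"
        and k = "\<lambda>p. (fst (p Direct_Distance), snd (snd (p Direct_Fading)))"
        and k' = "\<lambda>p. fst (snd (p Interferers))", OF _ _ _ assms])
     (auto simp: source_value_def)

lemma nn_integral_direct:
  assumes "f \<in> borel_measurable (borel \<Otimes>\<^sub>M borel)"
  shows "(\<integral>\<^sup>+\<omega>. f (d0 \<omega>, h0 \<omega>) \<partial>M) = (\<integral>\<^sup>+\<omega>. (\<integral>\<^sup>+\<omega>'. f (d0 \<omega>, h0 \<omega>') \<partial>M) \<partial>M)"
  by (rule nn_integral_disjoint_sources[where A = "{Direct_Distance}" and B = "{Direct_Fading}"
        and k = "\<lambda>p. fst (p Direct_Distance)" and k' = "\<lambda>p. snd (snd (p Direct_Fading))", OF _ _ _ assms])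
     (auto simp: source_value_def)

lemma indep_fading_vectors: "indep_vars (\<lambda>_. borel) h UNIV"
proof -
  have "indep_vars (\<lambda>l. PiM {Interferer_Fading l} (\<lambda>_. source_space))
      (\<lambda>l \<omega>. \<lambda>s\<in>{Interferer_Fading l}. source_value s \<omega>) UNIV"
    by (rule indep_vars_restrict[OF indep_sources]) (auto simp: disjoint_family_on_def)
  then have "indep_vars (\<lambda>_. borel) (\<lambda>l \<omega>. (\<lambda>p. snd (snd (p (Interferer_Fading l))))
      (\<lambda>s\<in>{Interferer_Fading l}. source_value s \<omega>)) UNIV"
    by (rule indep_vars_compose2) auto
  then show ?thesis by (simp add: source_value_def)
qed

end

subsection \<open>Laplace transforms of the typical link\<close>

lemma (in prob_space) nn_integral_one_minus:
  fixes g :: "'a \<Rightarrow> real"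
  assumes [measurable]: "g \<in> borel_measurable M" and g: "\<And>\<omega>. 0 \<le> g \<omega>" "\<And>\<omega>. g \<omega> \<le> 1"
    and I: "(\<integral>\<^sup>+\<omega>. ennreal (g \<omega>) \<partial>M) = ennreal c" and c: "c \<ge> 0"
  shows "(\<integral>\<^sup>+\<omega>. ennreal (1 - g \<omega>) \<partial>M) = ennreal (1 - c)"
proof -
  have "(\<integral>\<^sup>+\<omega>. ennreal (1 - g \<omega>) \<partial>M) = (\<integral>\<^sup>+\<omega>. 1 - ennreal (g \<omega>) \<partial>M)"
    using g by (simp add: ennreal_minus[symmetric])
  also have "\<dots> = (\<integral>\<^sup>+\<omega>. 1 \<partial>M) - (\<integral>\<^sup>+\<omega>. ennreal (g \<omega>) \<partial>M)"
    using g I by (intro nn_integral_diff) auto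
  also have "\<dots> = ennreal (1 - c)"
    using c by (simp add: I emeasure_space_1 ennreal_minus[symmetric])
  finally show ?thesis .
qed

context typical_link
begin

text \<open>The fading is averaged with the positions and the value \<open>v\<close> of the direct
  fading frozen; finite products are passed to the limit. Each factor 1 / (1 + a l) is written as
  exp (- ln (1 + a l)), so that the result is exp of minus a sum over the points, the form to which
  the Laplace functional applies.\<close>

lemma nn_integral_fading_laplace:
  assumes v: "v \<noteq> 0" and a: "\<And>l. a l \<ge> 0"
  shows "(\<integral>\<^sup>+\<omega>. ennreal (exp_neg (\<Sum>l. ennreal (a l * interferer_gain v (h l \<omega>)))) \<partial>M)
    = ennreal (exp_neg (\<Sum>l. ennreal (ln (1 + a l))))"
proof (rule LIMSEQ_unique)
  let ?P = "\<lambda>n \<omega>. ennreal (\<Prod>l<n. exp_neg (ennreal (a l * interferer_gain v (h l \<omega>))))"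
  show "(\<lambda>n. \<integral>\<^sup>+\<omega>. ?P n \<omega> \<partial>M)
      \<longlonglongrightarrow> (\<integral>\<^sup>+\<omega>. ennreal (exp_neg (\<Sum>l. ennreal (a l * interferer_gain v (h l \<omega>)))) \<partial>M)"
  proof (rule nn_integral_dominated_convergence[where w = "\<lambda>_. 1"])
    show "AE \<omega> in M. ?P n \<omega> \<le> 1" for n
      by (auto intro!: prod_le_1)
    show "AE \<omega> in M. (\<lambda>n. ?P n \<omega>) \<longlonglongrightarrow> ennreal (exp_neg (\<Sum>l. ennreal (a l * interferer_gain v (h l \<omega>))))"
      by (intro AE_I2 tendsto_ennrealI exp_neg_suminf)
  qed (auto simp: emeasure_space_1)
  have "(\<integral>\<^sup>+\<omega>. ?P n \<omega> \<partial>M) = ennreal (\<Prod>l<n. exp_neg (ennreal (ln (1 + a l))))" for n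
  proof -
    have "(\<integral>\<^sup>+\<omega>. ?P n \<omega> \<partial>M) = (\<integral>\<^sup>+\<omega>. (\<Prod>l<n. ennreal (exp (- (a l * interferer_gain v (h l \<omega>))))) \<partial>M)"
      using a by (simp add: prod_ennreal)
    also have "\<dots> = (\<Prod>l<n. \<integral>\<^sup>+\<omega>. ennreal (exp (- (a l * interferer_gain v (h l \<omega>)))) \<partial>M)"
    proof (rule indep_vars_nn_integral)
      show "indep_vars (\<lambda>_. borel) (\<lambda>l \<omega>. ennreal (exp (- (a l * interferer_gain v (h l \<omega>))))) {..<n}"
        by (rule indep_vars_compose2[OF indep_vars_subset[OF indep_fading_vectors],
              where Y = "\<lambda>l w. ennreal (exp (- (a l * interferer_gain v w)))"]) auto
    qed auto
    also have "\<dots> = (\<Prod>l<n. ennreal (1 / (1 + a l)))"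
      by (intro prod.cong refl expectation_interferer_gain interferer_fading v a)
    also have "\<dots> = ennreal (\<Prod>l<n. 1 / (1 + a l))"
      using a by (intro prod_ennreal) (simp add: add_nonneg_nonneg)
    also have "(\<Prod>l<n. 1 / (1 + a l)) = (\<Prod>l<n. exp_neg (ennreal (ln (1 + a l))))"
    proof (intro prod.cong refl)
      show "1 / (1 + a l) = exp_neg (ennreal (ln (1 + a l)))" for l
        using a[of l] by (simp add: exp_minus divide_inverse)
    qed
    finally show ?thesis .
  qed
  then show "(\<lambda>n. \<integral>\<^sup>+\<omega>. ?P n \<omega> \<partial>M) \<longlonglongrightarrow> ennreal (exp_neg (\<Sum>l. ennreal (ln (1 + a l))))"
    by (simp add: tendsto_ennrealI exp_neg_suminf)
qed

text \<open>The counterpart of \<open>mrc_interference\<close> in [0, infinity]: divergence is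
  recorded as \<open>\<top>\<close>, whereas the real series would then have a meaningless
  value.\<close>

definition interference :: "real \<Rightarrow> 'w \<Rightarrow> ennreal" where
  "interference alpha \<omega> =
     (\<Sum>l. ennreal (interferer_gain (h0 \<omega>) (h l \<omega>) * norm (X l \<omega>) powr (- alpha)))"

lemma borel_measurable_interference [measurable]: "interference alpha \<in> borel_measurable M"
  unfolding interference_def by measurable

text \<open>The weight \<open>G\<close> may depend on the direct link and still factors out:
  averaging over the interferer fading leaves a function of the positions alone, and these are
  independent of (\<open>d0\<close>, \<open>h0\<close>).\<close>

lemma nn_integral_interference_laplace:
  assumes lam: "lam > 0" and alpha: "alpha > 2" and t: "t \<ge> 0"
    and G[measurable]: "G \<in> borel_measurable (borel \<Otimes>\<^sub>M borel)"
  shows "(\<integral>\<^sup>+\<omega>. G (d0 \<omega>, h0 \<omega>) * ennreal (exp_neg (ennreal t * interference alpha \<omega>)) \<partial>M)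
    = (\<integral>\<^sup>+\<omega>. G (d0 \<omega>, h0 \<omega>) \<partial>M)
        * ennreal (exp (- (lam * pi * t powr (2 / alpha) / nsinc (2 / alpha))))"
proof -
  define p where "p x = t * norm x powr (- alpha)" for x :: "real ^ 2"
  define \<phi> where "\<phi> x = ennreal (ln (1 + p x))" for x
  have p: "p x \<ge> 0" for x using t by (simp add: p_def)
  have [measurable]: "p \<in> borel_measurable borel" unfolding p_def by measurable
  have [measurable]: "\<phi> \<in> borel_measurable borel" unfolding \<phi>_def by measurable
  let ?f = "\<lambda>q. G (fst (fst q), snd (snd (fst q)))
      * ennreal (exp_neg (\<Sum>l. ennreal (p (fst (snd (fst q)) l) * interferer_gain (snd (snd (fst q))) (snd q l))))"
  have "(\<integral>\<^sup>+\<omega>. G (d0 \<omega>, h0 \<omega>) * ennreal (exp_neg (ennreal t * interference alpha \<omega>)) \<partial>M)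
      = (\<integral>\<^sup>+\<omega>. ?f ((d0 \<omega>, (\<lambda>l. X l \<omega>), h0 \<omega>), (\<lambda>l. h l \<omega>)) \<partial>M)"
  proof (intro nn_integral_cong)
    fix \<omega>
    have "ennreal t * interference alpha \<omega> = (\<Sum>l. ennreal (p (X l \<omega>) * interferer_gain (h0 \<omega>) (h l \<omega>)))"
      unfolding interference_def ennreal_suminf_cmult[symmetric] p_def
      using t by (simp add: ennreal_mult'[symmetric] mult_ac)
    then show "G (d0 \<omega>, h0 \<omega>) * ennreal (exp_neg (ennreal t * interference alpha \<omega>))
       = ?f ((d0 \<omega>, (\<lambda>l. X l \<omega>), h0 \<omega>), (\<lambda>l. h l \<omega>))" by simp
  qed
  also have "\<dots> = (\<integral>\<^sup>+\<omega>. (\<integral>\<^sup>+\<omega>'. ?f ((d0 \<omega>, (\<lambda>l. X l \<omega>), h0 \<omega>), (\<lambda>l. h l \<omega>')) \<partial>M) \<partial>M)"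
    by (rule nn_integral_interferer_fading) measurable
  also have "\<dots> = (\<integral>\<^sup>+\<omega>. G (d0 \<omega>, h0 \<omega>) * ennreal (exp_neg (\<Sum>l. \<phi> (X l \<omega>))) \<partial>M)"
  proof (rule nn_integral_cong_AE)
    show "AE \<omega> in M. (\<integral>\<^sup>+\<omega>'. ?f ((d0 \<omega>, (\<lambda>l. X l \<omega>), h0 \<omega>), (\<lambda>l. h l \<omega>')) \<partial>M)
        = G (d0 \<omega>, h0 \<omega>) * ennreal (exp_neg (\<Sum>l. \<phi> (X l \<omega>)))"
      using AE_complex_gaussian_nonzero[OF direct_fading direct_fading_measurable]
    proof eventually_elim
      case (elim \<omega>)
      then show ?case
        by (simp add: nn_integral_cmult nn_integral_fading_laplace p \<phi>_def)
    qed
  qed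
  also have "\<dots> = (\<integral>\<^sup>+\<omega>. (\<integral>\<^sup>+\<omega>'. G (d0 \<omega>, h0 \<omega>) * ennreal (exp_neg (\<Sum>l. \<phi> (X l \<omega>'))) \<partial>M) \<partial>M)"
    using nn_integral_positions[of "\<lambda>q. G (fst q) * ennreal (exp_neg (\<Sum>l. \<phi> (snd q l)))"]
    by simp
  also have "\<dots> = (\<integral>\<^sup>+\<omega>. G (d0 \<omega>, h0 \<omega>) \<partial>M) * (\<integral>\<^sup>+\<omega>. ennreal (exp_neg (\<Sum>l. \<phi> (X l \<omega>))) \<partial>M)"
    by (simp add: nn_integral_cmult nn_integral_multc)
  also have "(\<integral>\<^sup>+\<omega>. ennreal (exp_neg (\<Sum>l. \<phi> (X l \<omega>))) \<partial>M) = ennreal (expectation (\<lambda>\<omega>. exp_neg (\<Sum>l. \<phi> (X l \<omega>))))"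
    by (intro nn_integral_eq_integral integrable_const_bound[where B = 1]) auto
  also have "expectation (\<lambda>\<omega>. exp_neg (\<Sum>l. \<phi> (X l \<omega>)))
      = exp_neg (ennreal lam * (\<integral>\<^sup>+x. ennreal (1 - exp_neg (\<phi> x)) \<partial>lborel))"
    using lam by (intro ppp_laplace_functional interferers) auto
  \<comment> \<open>By the choice of \<open>\<phi>\<close> as a logarithm,
    \<open>exp_neg (\<phi> x)\<close> is the average 1 / (1 + p x) over the fading of an interferer
    at x.\<close>
  also have "(\<lambda>x. ennreal (1 - exp_neg (\<phi> x))) = (\<lambda>x. ennreal (1 - 1 / (1 + t * norm x powr (- alpha))))"
  proof
    show "ennreal (1 - exp_neg (\<phi> x)) = ennreal (1 - 1 / (1 + t * norm x powr (- alpha)))" for x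
      using p[of x] by (simp add: \<phi>_def exp_minus divide_inverse flip: p_def)
  qed
  also have "ennreal lam * (\<integral>\<^sup>+x. ennreal (1 - 1 / (1 + t * norm x powr (- alpha))) \<partial>(lborel :: (real ^ 2) measure))
      = ennreal (lam * pi * t powr (2 / alpha) / nsinc (2 / alpha))"
    unfolding nn_integral_path_loss_plane[OF alpha t]
    using lam by (simp add: ennreal_mult'[symmetric] mult_ac)
  also have "exp_neg \<dots> = exp (- (lam * pi * t powr (2 / alpha) / nsinc (2 / alpha)))"
    using lam alpha nsinc_pos[of "2 / alpha"] by simp
  finally show ?thesis .
qed

text \<open>\<open>P (I < \<infinity>) \<ge> E exp (- t I) \<rightarrow> 1\<close> as \<open>t \<rightarrow> 0\<close>.\<close>

lemma AE_interference_finite: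
  assumes lam: "lam > 0" and alpha: "alpha > 2"
  shows "AE \<omega> in M. interference alpha \<omega> < \<top>"
proof -
  define c where "c = lam * pi / nsinc (2 / alpha)"
  define A where "A = {\<omega> \<in> space M. interference alpha \<omega> < \<top>}"
  have [measurable]: "A \<in> sets M" unfolding A_def by measurable
  have le: "exp (- (c * t powr (2 / alpha))) \<le> prob A" if t: "t > 0" for t
  proof -
    have "ennreal (exp (- (c * t powr (2 / alpha)))) = (\<integral>\<^sup>+\<omega>. ennreal (exp_neg (ennreal t * interference alpha \<omega>)) \<partial>M)"
      using nn_integral_interference_laplace[OF lam alpha, of t "\<lambda>_. 1"] t
      by (simp add: emeasure_space_1 c_def)
    also have "\<dots> \<le> (\<integral>\<^sup>+\<omega>. indicator A \<omega> \<partial>M)"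
    proof (rule nn_integral_mono)
      fix \<omega> assume "\<omega> \<in> space M"
      then show "ennreal (exp_neg (ennreal t * interference alpha \<omega>)) \<le> indicator A \<omega>"
        using t by (cases "interference alpha \<omega> = \<top>") (auto simp: A_def ennreal_mult_top less_top)
    qed
    finally show ?thesis by (simp add: emeasure_eq_measure)
  qed
  have "((\<lambda>t. exp (- (c * t powr (2 / alpha)))) \<longlongrightarrow> 1) (at_right 0)"
    using alpha by real_asymp
  then have "1 \<le> prob A"
    by (rule tendsto_upperbound) (auto simp: eventually_at_right_less le intro: eventually_at_rightI[of 0 1])
  then have "prob A = 1" using prob_le_1[of A] by linarith
  from AE_prob_1[OF this] show ?thesis
    by eventually_elim (simp add: A_def)
qed

text \<open>A finite sum in [0, infinity] makes the real series summable, so that its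
  \<open>suminf\<close> is the true sum.\<close>

lemma AE_mrc_interference:
  assumes "lam > 0" "alpha > 2"
  shows "AE \<omega> in M. 0 \<le> mrc_interference alpha X h0 h \<omega>
    \<and> interference alpha \<omega> = ennreal (mrc_interference alpha X h0 h \<omega>)"
  using AE_interference_finite[OF assms]
proof eventually_elim
  case (elim \<omega>)
  let ?a = "\<lambda>l. interferer_gain (h0 \<omega>) (h l \<omega>) * norm (X l \<omega>) powr (- alpha)"
  have nn: "0 \<le> ?a l" for l by simp
  have "summable ?a"
    using elim by (intro summable_suminf_not_top nn) (simp add: interference_def less_top)
  then show ?case
    unfolding interference_def mrc_interference_def
    using suminf_ennreal2[OF nn] suminf_nonneg[OF _ nn] by simp
qed

lemma nn_integral_direct_link:
  assumes t: "t \<ge> 0"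
  shows "(\<integral>\<^sup>+\<omega>. ennreal (1 - exp (- (t * ((norm (h0 \<omega>))\<^sup>2 * d0 \<omega> powr (- alpha))))) \<partial>M)
    = (\<integral>\<^sup>+r\<in>{1..R_d}. ennreal (2 * r / (R_d\<^sup>2 - 1)) * ennreal (1 - 1 / (1 + t * r powr (- alpha)) ^ CARD('n)) \<partial>lborel)"
proof -
  have "(\<integral>\<^sup>+\<omega>. ennreal (1 - exp (- (t * ((norm (h0 \<omega>))\<^sup>2 * d0 \<omega> powr (- alpha))))) \<partial>M)
      = (\<integral>\<^sup>+\<omega>. (\<integral>\<^sup>+\<omega>'. ennreal (1 - exp (- (t * ((norm (h0 \<omega>'))\<^sup>2 * d0 \<omega> powr (- alpha))))) \<partial>M) \<partial>M)"
    using nn_integral_direct[of "\<lambda>(d, v). ennreal (1 - exp (- (t * ((norm v)\<^sup>2 * d powr (- alpha)))))"]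
    by simp
  also have "\<dots> = (\<integral>\<^sup>+\<omega>. ennreal (1 - 1 / (1 + t * d0 \<omega> powr (- alpha)) ^ CARD('n)) \<partial>M)"
  proof (intro nn_integral_cong nn_integral_one_minus)
    fix \<omega>
    show "(\<integral>\<^sup>+\<omega>'. ennreal (exp (- (t * ((norm (h0 \<omega>'))\<^sup>2 * d0 \<omega> powr (- alpha))))) \<partial>M)
        = ennreal (1 / (1 + t * d0 \<omega> powr (- alpha)) ^ CARD('n))"
      using expectation_exp_norm_square[OF direct_fading, of "t * d0 \<omega> powr (- alpha)"] t
      by (simp add: mult_ac)
  qed (use t in auto)
  also have "\<dots> = (\<integral>\<^sup>+r. indicator {1..R_d} r * ennreal (2 * r / (R_d\<^sup>2 - 1))
      * ennreal (1 - 1 / (1 + t * r powr (- alpha)) ^ CARD('n)) \<partial>lborel)"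
    by (rule distributed_nn_integral[OF direct_distance, symmetric]) measurable
  finally show ?thesis by (simp add: mult_ac)
qed

end

subsection \<open>The spectral efficiency\<close>

text \<open>The binomial theorem with the term n = 0 removed. It identifies the fraction of the
  theorem with one minus a Gamma transform.\<close>

lemma sum_choose_powr_div:
  fixes y b :: real
  assumes "y > 0"
  shows "(\<Sum>n=1..N. real (N choose n) * y powr (real n * b)) / (1 + y powr b) ^ N
    = 1 - 1 / (1 + y powr b) ^ N"
proof -
  have "(1 + y powr b) ^ N = (\<Sum>n\<in>{0..N}. real (N choose n) * y powr (real n * b))"
    using assms binomial_ring[of "y powr b" 1 N]
    by (simp add: powr_powr[symmetric] powr_realpow mult.commute add.commute atMost_atLeast0
          flip: powr_realpow)
  also have "\<dots> = 1 + (\<Sum>n=1..N. real (N choose n) * y powr (real n * b))"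
    using assms by (simp add: sum.atLeast_Suc_atMost)
  finally have "(\<Sum>n=1..N. real (N choose n) * y powr (real n * b)) = (1 + y powr b) ^ N - 1" by simp
  moreover have "1 + y powr b \<noteq> 0" using powr_ge_zero[of y b] by linarith
  ultimately show ?thesis by (simp add: diff_divide_distrib)
qed

text \<open>Bernoulli's inequality for 1 / (1 + w) = 1 - w / (1 + w). The linear bound in w is what
  compensates the factor 1 / u near u = 0.\<close>

lemma one_minus_inverse_power_bounds:
  fixes w :: real
  assumes "w \<ge> 0"
  shows "0 \<le> 1 - 1 / (1 + w) ^ N" "1 - 1 / (1 + w) ^ N \<le> real N * w"
proof -
  show "0 \<le> 1 - 1 / (1 + w) ^ N" using assms by (simp add: divide_le_eq_1)
  have "1 + real N * (- (w / (1 + w))) \<le> (1 + (- (w / (1 + w)))) ^ N"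
    using assms by (intro Bernoulli_inequality) (simp add: divide_le_eq_1)
  also have "1 + (- (w / (1 + w))) = 1 / (1 + w)" using assms by (simp add: field_simps)
  finally have "1 - 1 / (1 + w) ^ N \<le> real N * (w / (1 + w))" by (simp add: power_one_over)
  also have "\<dots> \<le> real N * w"
    using assms by (intro mult_left_mono) (auto simp: divide_le_eq algebra_simps)
  finally show "1 - 1 / (1 + w) ^ N \<le> real N * w" .
qed

text \<open>The inner integrand of the theorem for k = sinc (2 / alpha) / (lam pi), with the
  binomial fraction in closed form; (k u)^(alpha / 2) is the Laplace variable.\<close>

definition rate_density :: "real \<Rightarrow> real \<Rightarrow> real \<Rightarrow> nat \<Rightarrow> real \<Rightarrow> real \<Rightarrow> real" where
  "rate_density alpha k snr N r u =
     1 / u * exp (- ((k * u) powr (alpha / 2) / snr) - u)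
       * (1 - 1 / (1 + (k * u) powr (alpha / 2) * r powr (- alpha)) ^ N)"

lemma borel_measurable_rate_density [measurable]:
  "case_prod (rate_density alpha k snr N) \<in> borel_measurable (borel \<Otimes>\<^sub>M borel)"
  unfolding rate_density_def by measurable

text \<open>For r >= 1 the factor r^(-alpha) is at most 1, so the bound is uniform in r. Its last
  factor is the integrand of Gamma (alpha / 2), which yields integrability in u and boundedness of
  the inner integral in r together.\<close>

lemma rate_density_bounds:
  assumes k: "k > 0" and snr: "snr > 0" and alpha: "alpha > 2" and r: "r \<ge> 1" and u: "u > 0"
  shows "0 \<le> rate_density alpha k snr N r u"
    and "rate_density alpha k snr N r u
      \<le> real N * k powr (alpha / 2) * (indicator {0..} u * u powr (alpha / 2 - 1) / exp u)"
proof -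
  let ?W = "(k * u) powr (alpha / 2)"
  let ?w = "?W * r powr (- alpha)"
  show "0 \<le> rate_density alpha k snr N r u"
    unfolding rate_density_def using u one_minus_inverse_power_bounds(1)[of ?w N] by simp
  have "r powr (- alpha) \<le> 1"
    using powr_mono2'[of "- alpha" 1 r] r alpha by simp
  then have w: "?w \<le> ?W" using mult_left_mono[of "r powr (- alpha)" 1 ?W] by simp
  have "rate_density alpha k snr N r u \<le> 1 / u * exp (- u) * (real N * ?W)"
    unfolding rate_density_def
  proof (intro mult_mono)
    show "1 - 1 / (1 + ?w) ^ N \<le> real N * ?W"
      using one_minus_inverse_power_bounds(2)[of ?w N] mult_left_mono[OF w, of "real N"] by simp
  qed (use u snr one_minus_inverse_power_bounds(1)[of ?w N] in auto)
  also have "\<dots> = real N * k powr (alpha / 2) * (indicator {0..} u * u powr (alpha / 2 - 1) / exp u)"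
    using k u by (simp add: powr_mult powr_diff exp_minus inverse_eq_divide)
  finally show "rate_density alpha k snr N r u
      \<le> real N * k powr (alpha / 2) * (indicator {0..} u * u powr (alpha / 2 - 1) / exp u)" .
qed

lemma rate_density_integrable:
  assumes k: "k > 0" and snr: "snr > 0" and alpha: "alpha > 2" and r: "r \<ge> 1"
  shows "set_integrable lborel {0<..} (rate_density alpha k snr N r)" (is ?int)
    and "(\<integral>\<^sup>+u\<in>{0<..}. ennreal (rate_density alpha k snr N r u) \<partial>lborel)
      = ennreal (LINT u:{0<..}|lborel. rate_density alpha k snr N r u)" (is ?eq)
    and "0 \<le> (LINT u:{0<..}|lborel. rate_density alpha k snr N r u)" (is ?nn)
    and "(LINT u:{0<..}|lborel. rate_density alpha k snr N r u)
      \<le> real N * k powr (alpha / 2) * Gamma (alpha / 2)" (is ?le)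
proof -
  let ?C = "real N * k powr (alpha / 2)"
  let ?f = "\<lambda>u. indicator {0<..} u *\<^sub>R rate_density alpha k snr N r u"
  have [measurable]: "rate_density alpha k snr N r \<in> borel_measurable borel"
    using measurable_Pair2[OF borel_measurable_rate_density, of r] by simp
  have nn: "0 \<le> ?f u" for u
    using rate_density_bounds(1)[OF assms, of u N] by (simp add: indicator_def)
  have eq: "(\<integral>\<^sup>+u. ennreal (?f u) \<partial>lborel) = (\<integral>\<^sup>+u\<in>{0<..}. ennreal (rate_density alpha k snr N r u) \<partial>lborel)"
    by (intro nn_integral_cong) (simp add: indicator_def)
  have "(\<integral>\<^sup>+u. ennreal (?f u) \<partial>lborel)
      \<le> (\<integral>\<^sup>+u. ennreal ?C * ennreal (indicator {0..} u * u powr (alpha / 2 - 1) / exp u) \<partial>lborel)"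
  proof (rule nn_integral_mono)
    show "ennreal (?f u) \<le> ennreal ?C * ennreal (indicator {0..} u * u powr (alpha / 2 - 1) / exp u)" for u
      using rate_density_bounds(2)[OF assms, of u N]
      by (cases "u > 0") (simp_all add: ennreal_mult'[symmetric] ennreal_leI)
  qed
  also have "\<dots> = ennreal ?C * ennreal (Gamma (alpha / 2))"
    using alpha by (subst nn_integral_cmult) (auto simp: Gamma_conv_nn_integral_real)
  also have "\<dots> = ennreal (?C * Gamma (alpha / 2))"
    by (simp add: ennreal_mult')
  finally have bound: "(\<integral>\<^sup>+u. ennreal (?f u) \<partial>lborel) \<le> ennreal (?C * Gamma (alpha / 2))" .
  have int: "integrable lborel ?f"
    by (rule integrableI_nonneg) (use nn bound in \<open>auto intro: le_less_trans\<close>)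
  then show ?int by (simp add: set_integrable_def)
  have I: "(\<integral>\<^sup>+u. ennreal (?f u) \<partial>lborel) = ennreal (LINT u:{0<..}|lborel. rate_density alpha k snr N r u)"
    unfolding set_lebesgue_integral_def using int nn by (intro nn_integral_eq_integral) auto
  then show ?eq unfolding eq .
  show ?nn unfolding set_lebesgue_integral_def by (intro Bochner_Integration.integral_nonneg nn)
  show ?le using bound alpha unfolding I by (subst (asm) ennreal_le_iff) (auto intro!: mult_nonneg_nonneg Gamma_real_nonneg)
qed

context typical_link
begin

lemma borel_measurable_mrc_sinr [measurable]: "mrc_sinr alpha SNR d0 X h0 h \<in> borel_measurable M"
  unfolding mrc_sinr_def[abs_def] mrc_interference_def[abs_def] by measurable

text \<open>All integrands are nonnegative, so the expectation is exchanged with the integral over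
  u, and then u with r, before anything is known to be finite.\<close>

lemma nn_integral_ln_sinr:
  fixes alpha SNR :: real
  defines "k \<equiv> nsinc (2 / alpha) / (lam * pi)"
  assumes lam: "lam > 0" and alpha: "alpha > 2" and SNR: "SNR > 0" and R: "R_d > 1"
  shows "(\<integral>\<^sup>+\<omega>. ennreal (ln (1 + mrc_sinr alpha SNR d0 X h0 h \<omega>)) \<partial>M)
    = (\<integral>\<^sup>+r\<in>{1..R_d}. ennreal (alpha / 2 * (2 * r / (R_d\<^sup>2 - 1)))
        * (\<integral>\<^sup>+u\<in>{0<..}. ennreal (rate_density alpha k SNR CARD('n) r u) \<partial>lborel) \<partial>lborel)"
proof -
  define b where "b = alpha / 2"
  define W where "W u = (k * u) powr b" for u
  define a where "a \<omega> = (norm (h0 \<omega>))\<^sup>2 * d0 \<omega> powr (- alpha)" for \<omega>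
  define J where "J = interference alpha"
  have b: "b > 0" using alpha by (simp add: b_def)
  have S: "nsinc (2 / alpha) > 0" using alpha by (intro nsinc_pos) auto
  have k: "k > 0" using S lam by (simp add: k_def)
  have W: "W u \<ge> 0" for u by (simp add: W_def)
  have a: "a \<omega> \<ge> 0" for \<omega> by (simp add: a_def)
  have [measurable]: "W \<in> borel_measurable borel" "a \<in> borel_measurable M" "J \<in> borel_measurable M"
    unfolding W_def a_def J_def by measurable
  have R2: "R_d\<^sup>2 - 1 > 0" using R by (simp add: power2_eq_square less_1_mult)
  interpret P: pair_sigma_finite M lborel ..
  let ?c = "\<lambda>u. b / u * exp (- (W u / SNR))"
  let ?g = "\<lambda>u \<omega>. ennreal (1 - exp (- (W u * a \<omega>)))"
  have c: "?c u \<ge> 0" if "u > 0" for u using that b by simp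
  have "(\<integral>\<^sup>+\<omega>. ennreal (ln (1 + mrc_sinr alpha SNR d0 X h0 h \<omega>)) \<partial>M)
    = (\<integral>\<^sup>+\<omega>. (\<integral>\<^sup>+u. ennreal (?c u) * (?g u \<omega> * ennreal (exp_neg (ennreal (W u) * J \<omega>))) * indicator {0<..} u \<partial>lborel) \<partial>M)"
  proof (rule nn_integral_cong_AE)
    show "AE \<omega> in M. ennreal (ln (1 + mrc_sinr alpha SNR d0 X h0 h \<omega>))
        = (\<integral>\<^sup>+u. ennreal (?c u) * (?g u \<omega> * ennreal (exp_neg (ennreal (W u) * J \<omega>))) * indicator {0<..} u \<partial>lborel)"
      using AE_mrc_interference[OF lam alpha]
    proof eventually_elim
      case (elim \<omega>)
      define i where "i = mrc_interference alpha X h0 h \<omega>"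
      have i: "i \<ge> 0" "J \<omega> = ennreal i" using elim by (auto simp: i_def J_def)
      have pos: "i + 1 / SNR > 0" using i SNR by (simp add: add_nonneg_pos)
      have "ennreal (ln (1 + mrc_sinr alpha SNR d0 X h0 h \<omega>)) = ennreal (ln (1 + a \<omega> / (i + 1 / SNR)))"
        by (simp add: mrc_sinr_def a_def i_def)
      also have "\<dots> = (\<integral>\<^sup>+u\<in>{0<..}. ennreal (b / u * (1 - exp (- (W u * a \<omega>))) * exp (- (W u * (i + 1 / SNR)))) \<partial>lborel)"
        unfolding W_def by (rule nn_integral_frullani_powr[OF k b a pos, symmetric])
      also have "\<dots> = (\<integral>\<^sup>+u\<in>{0<..}. ennreal (?c u) * (?g u \<omega> * ennreal (exp_neg (ennreal (W u) * J \<omega>))) \<partial>lborel)"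
      proof (rule set_nn_integral_cong[OF refl refl])
        fix u :: real assume "u \<in> space lborel \<inter> {0<..}"
        then have u: "u > 0" by simp
        have e: "exp (- (W u * (i + 1 / SNR))) = exp (- (W u / SNR)) * exp (- (W u * i))"
          by (simp add: algebra_simps flip: exp_add)
        have j: "exp_neg (ennreal (W u) * J \<omega>) = exp (- (W u * i))"
          using W[of u] i by (simp flip: ennreal_mult)
        show "ennreal (b / u * (1 - exp (- (W u * a \<omega>))) * exp (- (W u * (i + 1 / SNR))))
            = ennreal (?c u) * (?g u \<omega> * ennreal (exp_neg (ennreal (W u) * J \<omega>)))"
          unfolding e j using u b W[of u] a[of \<omega>]
          by (simp add: mult_ac flip: ennreal_mult)
      qed
      finally show ?case .
    qed
  qed
  also have "\<dots> = (\<integral>\<^sup>+u. (\<integral>\<^sup>+\<omega>. ennreal (?c u) * (?g u \<omega> * ennreal (exp_neg (ennreal (W u) * J \<omega>))) * indicator {0<..} u \<partial>M) \<partial>lborel)"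
    by (rule P.Fubini'[symmetric]) measurable
  also have "\<dots> = (\<integral>\<^sup>+u. (\<integral>\<^sup>+r. ennreal (alpha / 2 * (2 * r / (R_d\<^sup>2 - 1)))
      * ennreal (rate_density alpha k SNR CARD('n) r u) * indicator {0<..} u * indicator {1..R_d} r \<partial>lborel) \<partial>lborel)"
  proof (rule nn_integral_cong)
    fix u :: real
    show "(\<integral>\<^sup>+\<omega>. ennreal (?c u) * (?g u \<omega> * ennreal (exp_neg (ennreal (W u) * J \<omega>))) * indicator {0<..} u \<partial>M)
       = (\<integral>\<^sup>+r. ennreal (alpha / 2 * (2 * r / (R_d\<^sup>2 - 1)))
          * ennreal (rate_density alpha k SNR CARD('n) r u) * indicator {0<..} u * indicator {1..R_d} r \<partial>lborel)"
    proof (cases "u > 0")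
      case u: True
      \<comment> \<open>The scale k is chosen for this identity: \<open>W u powr (2 / alpha)\<close>
        is k u, so the interference contributes exactly exp (- u).\<close>
      have exponent: "lam * pi * W u powr (2 / alpha) / nsinc (2 / alpha) = u"
        using u k lam alpha S by (simp add: W_def b_def powr_powr k_def)
      have "(\<integral>\<^sup>+\<omega>. ennreal (?c u) * (?g u \<omega> * ennreal (exp_neg (ennreal (W u) * J \<omega>))) * indicator {0<..} u \<partial>M)
         = ennreal (?c u) * (\<integral>\<^sup>+\<omega>. ?g u \<omega> * ennreal (exp_neg (ennreal (W u) * J \<omega>)) \<partial>M)"
        using u by (simp add: nn_integral_cmult)
      also have "(\<integral>\<^sup>+\<omega>. ?g u \<omega> * ennreal (exp_neg (ennreal (W u) * J \<omega>)) \<partial>M)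
         = (\<integral>\<^sup>+\<omega>. ?g u \<omega> \<partial>M) * ennreal (exp (- u))"
        using nn_integral_interference_laplace[OF lam alpha W[of u],
            of "\<lambda>q. ennreal (1 - exp (- (W u * ((norm (snd q))\<^sup>2 * fst q powr (- alpha)))))"]
        by (simp add: a_def J_def exponent)
      also have "(\<integral>\<^sup>+\<omega>. ?g u \<omega> \<partial>M) = (\<integral>\<^sup>+r\<in>{1..R_d}. ennreal (2 * r / (R_d\<^sup>2 - 1))
          * ennreal (1 - 1 / (1 + W u * r powr (- alpha)) ^ CARD('n)) \<partial>lborel)"
        unfolding a_def by (rule nn_integral_direct_link[OF W])
      also have "ennreal (?c u) * (\<dots> * ennreal (exp (- u)))
         = (\<integral>\<^sup>+r. ennreal (?c u) * (ennreal (2 * r / (R_d\<^sup>2 - 1))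
          * ennreal (1 - 1 / (1 + W u * r powr (- alpha)) ^ CARD('n)) * indicator {1..R_d} r * ennreal (exp (- u))) \<partial>lborel)"
        by (simp add: nn_integral_cmult nn_integral_multc)
      also have "\<dots> = (\<integral>\<^sup>+r. ennreal (alpha / 2 * (2 * r / (R_d\<^sup>2 - 1)))
          * ennreal (rate_density alpha k SNR CARD('n) r u) * indicator {0<..} u * indicator {1..R_d} r \<partial>lborel)"
      proof (rule nn_integral_cong)
        fix r :: real
        show "ennreal (?c u) * (ennreal (2 * r / (R_d\<^sup>2 - 1))
            * ennreal (1 - 1 / (1 + W u * r powr (- alpha)) ^ CARD('n)) * indicator {1..R_d} r * ennreal (exp (- u)))
          = ennreal (alpha / 2 * (2 * r / (R_d\<^sup>2 - 1)))
            * ennreal (rate_density alpha k SNR CARD('n) r u) * indicator {0<..} u * indicator {1..R_d} r"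
        proof (cases "r \<in> {1..R_d}")
          case True
          define q where "q = 1 - 1 / (1 + W u * r powr (- alpha)) ^ CARD('n)"
          have q: "q \<ge> 0"
            unfolding q_def using W[of u] by (intro one_minus_inverse_power_bounds) simp
          have d: "2 * r / (R_d\<^sup>2 - 1) \<ge> 0" using True R2 by simp
          have rd: "rate_density alpha k SNR CARD('n) r u = 1 / u * (exp (- (W u / SNR)) * exp (- u)) * q"
            by (simp add: rate_density_def W_def b_def q_def flip: exp_add)
          show ?thesis
            unfolding rd q_def[symmetric] using True q d u b c[OF u]
            by (simp add: b_def mult_ac flip: ennreal_mult)
        qed simp
      qed
      finally show ?thesis .
    qed simp
  qed
  also have "\<dots> = (\<integral>\<^sup>+r. (\<integral>\<^sup>+u. ennreal (alpha / 2 * (2 * r / (R_d\<^sup>2 - 1)))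
      * ennreal (rate_density alpha k SNR CARD('n) r u) * indicator {0<..} u * indicator {1..R_d} r \<partial>lborel) \<partial>lborel)"
    by (rule lborel_pair.Fubini') measurable
  also have "\<dots> = (\<integral>\<^sup>+r\<in>{1..R_d}. ennreal (alpha / 2 * (2 * r / (R_d\<^sup>2 - 1)))
        * (\<integral>\<^sup>+u\<in>{0<..}. ennreal (rate_density alpha k SNR CARD('n) r u) \<partial>lborel) \<partial>lborel)"
  proof (rule nn_integral_cong)
    fix r :: real
    show "(\<integral>\<^sup>+u. ennreal (alpha / 2 * (2 * r / (R_d\<^sup>2 - 1)))
        * ennreal (rate_density alpha k SNR CARD('n) r u) * indicator {0<..} u * indicator {1..R_d} r \<partial>lborel)
      = ennreal (alpha / 2 * (2 * r / (R_d\<^sup>2 - 1)))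
        * (\<integral>\<^sup>+u\<in>{0<..}. ennreal (rate_density alpha k SNR CARD('n) r u) \<partial>lborel) * indicator {1..R_d} r"
      by (cases "r \<in> {1..R_d}") (simp_all add: nn_integral_cmult mult.assoc)
  qed
  finally show ?thesis .
qed

end

theorem theorem1:
  fixes M :: "'w measure"
    and lam alpha R_d SNR :: real
    and d0 :: "'w \<Rightarrow> real"
    and X :: "nat \<Rightarrow> 'w \<Rightarrow> real ^ 2"
    and h0 :: "'w \<Rightarrow> complex ^ 'n"
    and h :: "nat \<Rightarrow> 'w \<Rightarrow> complex ^ 'n"
  assumes "lam > 0" and "alpha > 2" and "R_d > 1" and "SNR > 0"
    and "typical_link M lam R_d d0 X h0 h"
  shows "let N = CARD('n);
             y = (\<lambda>r u. nsinc (2 / alpha) * u / (lam * pi * r\<^sup>2));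
             f = (\<lambda>r u. 1 / u
                  * exp (- ((nsinc (2 / alpha) * u) powr (alpha / 2)
                              / ((lam * pi) powr (alpha / 2) * SNR)) - u)
                  * ((\<Sum>n=1..N. real (N choose n) * y r u powr (real n * (alpha / 2)))
                      / (1 + y r u powr (alpha / 2)) ^ N));
             g = (\<lambda>r. (LINT u:{0<..}|lborel. f r u) * (2 * r / (R_d\<^sup>2 - 1)))
         in integrable M (\<lambda>\<omega>. log 2 (1 + mrc_sinr alpha SNR d0 X h0 h \<omega>))
          \<and> (\<forall>r\<in>{1..R_d}. set_integrable lborel {0<..} (f r))
          \<and> set_integrable lborel {1..R_d} g
          \<and> lam * (LINT \<omega>|M. log 2 (1 + mrc_sinr alpha SNR d0 X h0 h \<omega>))
              = lam * alpha / (2 * ln 2) * (LINT r:{1..R_d}|lborel. g r)"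
proof -
  interpret typical_link M lam R_d d0 X h0 h by fact
  define k where "k = nsinc (2 / alpha) / (lam * pi)"
  define y where "y = (\<lambda>r u. nsinc (2 / alpha) * u / (lam * pi * r\<^sup>2))"
  define f where "f = (\<lambda>r u. 1 / u
                  * exp (- ((nsinc (2 / alpha) * u) powr (alpha / 2)
                              / ((lam * pi) powr (alpha / 2) * SNR)) - u)
                  * ((\<Sum>n=1..CARD('n). real (CARD('n) choose n) * y r u powr (real n * (alpha / 2)))
                      / (1 + y r u powr (alpha / 2)) ^ CARD('n)))"
  define g where "g = (\<lambda>r. (LINT u:{0<..}|lborel. f r u) * (2 * r / (R_d\<^sup>2 - 1)))"
  let ?rate = "rate_density alpha k SNR CARD('n)"
  let ?L = "\<lambda>r. LINT u:{0<..}|lborel. ?rate r u"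
  note lam = assms(1) and alpha = assms(2) and R = assms(3) and SNR = assms(4)
  have S: "nsinc (2 / alpha) > 0" using alpha by (intro nsinc_pos) auto
  have k: "k > 0" using S lam by (simp add: k_def)
  have R2: "R_d\<^sup>2 - 1 > 0" using R by (simp add: power2_eq_square less_1_mult)
  note rate = rate_density_integrable[OF k SNR alpha]
  \<comment> \<open>Positivity of r and u licenses the power rules: y = k u r^(-2) turns y^(alpha /
    2) into (k u)^(alpha / 2) r^(-alpha).\<close>
  have f_eq: "f r u = ?rate r u" if r: "r \<ge> 1" and u: "u > 0" for r u
  proof -
    have exponent: "(nsinc (2 / alpha) * u) powr (alpha / 2) / ((lam * pi) powr (alpha / 2) * SNR) = (k * u) powr (alpha / 2) / SNR"
      using S u lam by (simp add: k_def powr_divide)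
    have w: "y r u powr (alpha / 2) = (k * u) powr (alpha / 2) * r powr (- alpha)"
    proof -
      have "y r u = k * u * r powr (- 2)"
        using r by (simp add: y_def k_def powr_minus_divide)
      then show ?thesis
        using r k u by (simp add: powr_mult powr_powr)
    qed
    have pos: "y r u > 0" using S lam r u by (simp add: y_def)
    show ?thesis
      unfolding f_def rate_density_def exponent sum_choose_powr_div[OF pos] by (simp add: w)
  qed
  have f_int: "(LINT u:{0<..}|lborel. f r u) = ?L r" if "r \<ge> 1" for r
    using f_eq[OF that] by (intro set_lebesgue_integral_cong) auto
  have f_integrable: "set_integrable lborel {0<..} (f r)" if "r \<in> {1..R_d}" for r
    using rate(1)[of r "CARD('n)"] f_eq[of r] that
    by (subst set_integrable_cong[OF refl refl, of _ _ "?rate r"]) auto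
  define G where "G = (\<lambda>r. ?L r * (2 * r / (R_d\<^sup>2 - 1)))"
  have [measurable]: "G \<in> borel_measurable borel"
    unfolding G_def set_lebesgue_integral_def by measurable
  have G_nn: "0 \<le> G r" if "r \<in> {1..R_d}" for r
    using that rate(3)[of r "CARD('n)"] R2 by (simp add: G_def)
  \<comment> \<open>The uniform bound on the inner integral times the largest value of the distance
    density, attained at \<open>R_d\<close>.\<close>
  define C where "C = real CARD('n) * k powr (alpha / 2) * Gamma (alpha / 2) * (2 * R_d / (R_d\<^sup>2 - 1))"
  have G_le: "G r \<le> C" if "r \<in> {1..R_d}" for r
    unfolding G_def C_def using that R2 alpha rate(3)[of r "CARD('n)"] rate(4)[of r "CARD('n)"]
    by (intro mult_mono divide_right_mono) (auto intro!: mult_nonneg_nonneg Gamma_real_nonneg)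
  have G_integrable: "set_integrable lborel {1..R_d} G"
    unfolding set_integrable_def
  proof (rule integrableI_bounded_set_indicator[where B = C])
    show "AE r in lborel. r \<in> {1..R_d} \<longrightarrow> norm (G r) \<le> C"
      using G_nn G_le by auto
  qed (use R in auto)
  have g_eq: "g r = G r" if "r \<in> {1..R_d}" for r
    using f_int[of r] that by (simp add: g_def G_def)
  have g_integrable: "set_integrable lborel {1..R_d} g"
    using G_integrable g_eq by (subst set_integrable_cong[OF refl refl, of _ _ G]) auto
  have g_int: "(LINT r:{1..R_d}|lborel. g r) = (LINT r:{1..R_d}|lborel. G r)"
    using g_eq by (intro set_lebesgue_integral_cong) auto
  have G_int_nn: "0 \<le> (LINT r:{1..R_d}|lborel. G r)"
    unfolding set_lebesgue_integral_def using G_nn by (intro Bochner_Integration.integral_nonneg) (simp add: indicator_def)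
  have "(\<integral>\<^sup>+\<omega>. ennreal (ln (1 + mrc_sinr alpha SNR d0 X h0 h \<omega>)) \<partial>M)
      = (\<integral>\<^sup>+r. ennreal (alpha / 2) * ennreal (indicator {1..R_d} r *\<^sub>R G r) \<partial>lborel)"
    unfolding nn_integral_ln_sinr[OF lam alpha SNR R] k_def[symmetric]
  proof (rule nn_integral_cong)
    fix r
    show "ennreal (alpha / 2 * (2 * r / (R_d\<^sup>2 - 1)))
        * (\<integral>\<^sup>+u\<in>{0<..}. ennreal (?rate r u) \<partial>lborel) * indicator {1..R_d} r
      = ennreal (alpha / 2) * ennreal (indicator {1..R_d} r *\<^sub>R G r)"
      using rate(2,3)[of r "CARD('n)"] alpha R2
      by (cases "r \<in> {1..R_d}") (auto simp: G_def mult_ac simp flip: ennreal_mult)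
  qed
  also have "\<dots> = ennreal (alpha / 2) * ennreal (LINT r:{1..R_d}|lborel. G r)"
  proof (subst nn_integral_cmult)
    have "(\<integral>\<^sup>+r. ennreal (indicator {1..R_d} r *\<^sub>R G r) \<partial>lborel) = ennreal (LINT r:{1..R_d}|lborel. G r)"
      unfolding set_lebesgue_integral_def
      using G_integrable G_nn unfolding set_integrable_def
      by (intro nn_integral_eq_integral) (auto simp: indicator_def)
    then show "ennreal (alpha / 2) * (\<integral>\<^sup>+r. ennreal (indicator {1..R_d} r *\<^sub>R G r) \<partial>lborel)
        = ennreal (alpha / 2) * ennreal (LINT r:{1..R_d}|lborel. G r)" by simp
  qed measurable
  also have "\<dots> = ennreal (alpha / 2 * (LINT r:{1..R_d}|lborel. G r))"
    using alpha by (intro ennreal_mult'[symmetric]) simp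
  finally have I: "(\<integral>\<^sup>+\<omega>. ennreal (ln (1 + mrc_sinr alpha SNR d0 X h0 h \<omega>)) \<partial>M)
      = ennreal (alpha / 2 * (LINT r:{1..R_d}|lborel. G r))" .
  \<comment> \<open>Nonnegativity holds only almost surely, since the real interference series has
    no controlled value where it diverges. It converts the finite integral \<open>I\<close> into
    integrability and the value of the real expectation.\<close>
  have "AE \<omega> in M. 0 \<le> ln (1 + mrc_sinr alpha SNR d0 X h0 h \<omega>)"
    using AE_mrc_interference[OF lam alpha]
  proof eventually_elim
    case (elim \<omega>)
    then have "0 \<le> mrc_sinr alpha SNR d0 X h0 h \<omega>" using SNR by (simp add: mrc_sinr_def)
    then show ?case by simp
  qed
  then have ln: "integrable M (\<lambda>\<omega>. ln (1 + mrc_sinr alpha SNR d0 X h0 h \<omega>))"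
      "(LINT \<omega>|M. ln (1 + mrc_sinr alpha SNR d0 X h0 h \<omega>)) = alpha / 2 * (LINT r:{1..R_d}|lborel. G r)"
    using I G_int_nn alpha
      nn_integral_eq_integrable[of "\<lambda>\<omega>. ln (1 + mrc_sinr alpha SNR d0 X h0 h \<omega>)" M
        "alpha / 2 * (LINT r:{1..R_d}|lborel. G r)"] by auto
  have "integrable M (\<lambda>\<omega>. log 2 (1 + mrc_sinr alpha SNR d0 X h0 h \<omega>))"
    unfolding log_def using ln(1) by simp
  moreover have "lam * (LINT \<omega>|M. log 2 (1 + mrc_sinr alpha SNR d0 X h0 h \<omega>))
      = lam * alpha / (2 * ln 2) * (LINT r:{1..R_d}|lborel. g r)"
    unfolding log_def g_int by (simp add: ln(2))
  ultimately show ?thesis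
    unfolding Let_def using f_integrable g_integrable
    unfolding f_def g_def y_def by blast
qed

end
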